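(* Let $-\infty\le a_-<0<a_+\le\infty$ and $I:=\mathbb R\cap[a_-,a_+]$. Take any function $\mathsf r\colon[-\infty,\infty]\to[-\infty,\infty]$. Then the following two conditions are equivalent to each other: (I) there exists a non-atomic zero-mean probability measure $\mu$ on $\mathcal B(\mathbb R)$ such that $\mathsf r_\mu=\mathsf r$, $\operatorname{supp}\mu=I$, and in a neighborhood of $0$ the measure $\mu$ has a continuous strictly positive density (with respect to Lebesgue measure); (II) all of the following hold: $\mathsf r(0)=0$; $\mathsf r$ is strictly decreasing on $[a_-,a_+]$; $\mathsf r$ is continuous on $[-\infty,\infty]$; $\mathsf r=a_+$ on $[-\infty,a_-]$ and $\mathsf r=a_-$ on $[a_+,\infty]$; $\mathsf r(\mathsf r(x))=x$ for all $x\in[a_-,a_+]$; and $\mathsf r$ is continuously differentiable in a neighborhood of $0$. Moreover, if either condition (I) or (II) holds, then necessarily $\mathsf r'(0)=-1$, that is, $\mathsf r(x)\sim-x$ as $x\to0$.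
   Context: $\mathcal B(\mathbb R)$ is the Borel $\sigma$-algebra; $\operatorname{supp}\mu$ is the set of all $x\in\mathbb R$ each of whose open neighborhoods has positive $\mu$-measure. A probability measure $\mu$ on $\mathcal B(\mathbb R)$ is zero-mean if $\int|x|\,\mu(dx)<\infty$ and $\int x\,\mu(dx)=0$. Continuity of $[-\infty,\infty]$-valued functions is with respect to the usual topology of the extended line. For a non-atomic zero-mean probability measure $\mu$ (extended to $[-\infty,\infty]$ by $\mu(\{\pm\infty\})=0$), define $G\colon[-\infty,\infty]\to[0,\infty)$ by $G(x)=\int_{(0,x]}z\,\mu(dz)$ for $x\in[0,\infty]$ and $G(x)=\int_{[x,0)}(-z)\,\mu(dz)$ for $x\in[-\infty,0]$; let $x_{+}(h)=\inf\{x\in[0,\infty]\colon G(x)\ge h\}$ and $x_{-}(h)=\sup\{x\in[-\infty,0]\colon G(x)\ge h\}$ (with $\inf\emptyset=\infty$, $\sup\emptyset=-\infty$); the reciprocating function $\mathsf r_\mu\colon[-\infty,\infty]\to[-\infty,\infty]$ of $\mu$ is $\mathsf r_\mu(x)=x_-(G(x))$ for $x\in[0,\infty]$ and $\mathsf r_\mu(x)=x_+(G(x))$ for $x\in[-\infty,0]$. *)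

theory Defs
  imports "HOL-Analysis.Analysis" "HOL-Probability.Probability" "HOL-Library.Landau_Symbols"
begin

definition atom_of :: "'a measure \<Rightarrow> 'a set \<Rightarrow> bool" where
  "atom_of M A \<longleftrightarrow> A \<in> sets M \<and> emeasure M A > 0 \<and>
     (\<forall>B\<in>sets M. B \<subseteq> A \<longrightarrow> emeasure M B = 0 \<or> emeasure M B = emeasure M A)"

definition non_atomic :: "'a measure \<Rightarrow> bool" where
  "non_atomic M \<longleftrightarrow> (\<nexists>A. atom_of M A)"

text \<open>Library \<^const>\<open>integrable\<close> is absolute integrability, so the first moment is required
  to exist in the Lebesgue sense.\<close>

definition zero_mean :: "real measure \<Rightarrow> bool" where
  "zero_mean \<mu> \<longleftrightarrow> integrable \<mu> (\<lambda>x. x) \<and> (LINT x|\<mu>. x) = 0"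

definition supp :: "'a::topological_space measure \<Rightarrow> 'a set" where
  "supp \<mu> = {x. \<forall>U. open U \<and> x \<in> U \<longrightarrow> emeasure \<mu> U > 0}"

definition cont_pos_density_near_0 :: "real measure \<Rightarrow> bool" where
  "cont_pos_density_near_0 \<mu> \<longleftrightarrow>
     (\<exists>U p. open U \<and> 0 \<in> U \<and> continuous_on U p \<and> (\<forall>x\<in>U. p x > (0::real)) \<and>
        (\<forall>A\<in>sets borel. A \<subseteq> U \<longrightarrow> emeasure \<mu> A = (\<integral>\<^sup>+x\<in>A. ennreal (p x) \<partial>lborel)))"

text \<open>The measure lives on the reals; extending it by \<open>0\<close> to the points \<open>\<plusminus>\<infinity>\<close> amounts to integrating
  over the real points of the intervals \<open>(0, x]\<close> and \<open>[x, 0)\<close> of the extended line.\<close>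

definition Gfun :: "real measure \<Rightarrow> ereal \<Rightarrow> real" where
  "Gfun \<mu> x =
     (if 0 \<le> x then LINT z:{z. 0 < z \<and> ereal z \<le> x}|\<mu>. z
      else LINT z:{z. x \<le> ereal z \<and> z < 0}|\<mu>. - z)"

text \<open>In the complete lattice \<^typ>\<open>ereal\<close>, \<open>Inf {} = \<infinity>\<close> and \<open>Sup {} = -\<infinity>\<close>.\<close>

definition x_plus :: "real measure \<Rightarrow> real \<Rightarrow> ereal" where
  "x_plus \<mu> h = Inf {x. 0 \<le> x \<and> h \<le> Gfun \<mu> x}"

definition x_minus :: "real measure \<Rightarrow> real \<Rightarrow> ereal" where
  "x_minus \<mu> h = Sup {x. x \<le> 0 \<and> h \<le> Gfun \<mu> x}"

text \<open>At the common point \<open>0\<close> of the two defining clauses, both give the value \<open>0\<close>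
  (and likewise for \<^const>\<open>Gfun\<close>).\<close>

definition reciprocating :: "real measure \<Rightarrow> ereal \<Rightarrow> ereal" where
  "reciprocating \<mu> x = (if 0 \<le> x then x_minus \<mu> (Gfun \<mu> x) else x_plus \<mu> (Gfun \<mu> x))"

text \<open>Differentiability at a real point includes that the function is finite near that point.\<close>

definition has_finite_derivative_at :: "(ereal \<Rightarrow> ereal) \<Rightarrow> real \<Rightarrow> real \<Rightarrow> bool" where
  "has_finite_derivative_at r D x \<longleftrightarrow>
     (\<exists>f. (\<forall>\<^sub>F y in nhds x. r (ereal y) = ereal (f y)) \<and> (f has_real_derivative D) (at x))"

definition cont_diff_near_0 :: "(ereal \<Rightarrow> ereal) \<Rightarrow> bool" where
  "cont_diff_near_0 r \<longleftrightarrow>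
     (\<exists>U D. open U \<and> 0 \<in> U \<and> (\<forall>x\<in>U. has_finite_derivative_at r (D x) x) \<and> continuous_on U D)"

definition condition_I :: "ereal \<Rightarrow> ereal \<Rightarrow> (ereal \<Rightarrow> ereal) \<Rightarrow> bool" where
  "condition_I a_minus a_plus r \<longleftrightarrow>
     (\<exists>\<mu> :: real measure. sets \<mu> = sets borel \<and> prob_space \<mu> \<and> non_atomic \<mu> \<and> zero_mean \<mu> \<and>
        reciprocating \<mu> = r \<and>
        supp \<mu> = {x. a_minus \<le> ereal x \<and> ereal x \<le> a_plus} \<and>
        cont_pos_density_near_0 \<mu>)"

definition condition_II :: "ereal \<Rightarrow> ereal \<Rightarrow> (ereal \<Rightarrow> ereal) \<Rightarrow> bool" where
  "condition_II a_minus a_plus r \<longleftrightarrow>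
     r 0 = 0 \<and>
     strict_antimono_on {a_minus..a_plus} r \<and>
     continuous_on UNIV r \<and>
     (\<forall>x \<le> a_minus. r x = a_plus) \<and> (\<forall>x \<ge> a_plus. r x = a_minus) \<and>
     (\<forall>x \<in> {a_minus..a_plus}. r (r x) = x) \<and>
     cont_diff_near_0 r"

end

theory Submission
  imports Defs
begin

text \<open>
  For a measure \<open>\<mu>\<close> as in (I), \<open>G\<close> is a continuous well on the extended line: it vanishes at \<open>0\<close>,
  is strictly monotone on each side of \<open>0\<close> up to the ends of the support, and has the same height at
  both ends because \<open>\<mu>\<close> has mean zero. The reciprocating function exchanges the two points of each
  level set of \<open>G\<close>, which gives all of (II) but the smoothness. Near \<open>0\<close> one has
  \<open>G' x = x * p x\<close> and \<open>G (r x) = G x\<close>; hence \<open>r' x = x * p x / (r x * p (r x))\<close> for \<open>x \<noteq> 0\<close>, and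
  \<open>G x / x\<^sup>2 \<longlongrightarrow> p 0 / 2\<close> forces \<open>r x / x \<longlongrightarrow> -1\<close>.

  Conversely, given \<open>r\<close> as in (II), let \<open>c x\<close> be \<open>x\<close> clamped to \<open>[a_minus, a_plus]\<close> and let
  \<open>K x = arctan (c x) - arctan (r x)\<close>. Then \<open>K\<close> is nondecreasing, strictly on \<open>[a_minus, a_plus]\<close>,
  and odd with respect to \<open>r\<close>, that is, \<open>K (r x) = - K x\<close>; so \<open>K\<^sup>2\<close> is a well whose level sets are
  exchanged by \<open>r\<close>. The measure \<open>\<bar>z\<bar>\<^sup>-\<^sup>1 d(K \<bar>K\<bar>)\<close> is finite because \<open>K\<close> is continuously
  differentiable near \<open>0\<close>, and after normalization its function \<open>G\<close> is a multiple of \<open>K\<^sup>2\<close>.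
\<close>

subsection \<open>Wells and the exchange of level points\<close>

text \<open>Isolates the properties of \<open>Gfun \<mu>\<close> that make the exchange of level
  points well behaved; both implications use it. Strictness stops at \<open>a\<close> and
  \<open>b\<close> because \<open>G\<close> is flat beyond the support, and \<open>level\<close> is
  the trace of mean zero.\<close>

locale potential_well =
  fixes a b :: ereal and G :: "ereal \<Rightarrow> real"
  assumes a_neg: "a < 0" and b_pos: "0 < b"
    and cont: "continuous_on UNIV G"
    and strict_right: "\<And>x y. 0 \<le> x \<Longrightarrow> x < y \<Longrightarrow> y \<le> b \<Longrightarrow> G x < G y"
    and strict_left: "\<And>x y. y \<le> 0 \<Longrightarrow> x < y \<Longrightarrow> a \<le> x \<Longrightarrow> G y < G x"
    and const_right: "\<And>x. b \<le> x \<Longrightarrow> G x = G b"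
    and const_left: "\<And>x. x \<le> a \<Longrightarrow> G x = G a"
    and level: "G a = G b"
begin

text \<open>The reciprocating function with \<open>x_plus\<close> and \<open>x_minus\<close>
  unfolded, for a general \<open>G\<close>.\<close>

definition opp :: "ereal \<Rightarrow> ereal" where
  "opp x = (if 0 \<le> x then Sup {y. y \<le> 0 \<and> G x \<le> G y} else Inf {y. 0 \<le> y \<and> G x \<le> G y})"

lemma a_le_b: "a \<le> b"
  using a_neg b_pos by simp

text \<open>Clamping both arguments at \<open>b\<close> changes no value of \<open>G\<close> and
  moves them into the range where \<open>strict_right\<close> applies.\<close>

lemma mono_right:
  assumes "0 \<le> x" "x \<le> y"
  shows "G x \<le> G y"
proof -
  have "G (min b x) = G x" "G (min b y) = G y"
    using const_right[of x] const_right[of y] by (simp_all add: min_def)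
  moreover have "G (min b x) \<le> G (min b y)"
  proof (cases "min b x = min b y")
    case False
    then have "min b x < min b y" using min.mono[OF order.refl assms(2)] by (simp only: less_le) simp
    then show ?thesis using strict_right[of "min b x" "min b y"] assms(1) b_pos by (simp add: less_imp_le)
  qed simp
  ultimately show ?thesis by simp
qed

lemma antimono_left:
  assumes "y \<le> 0" "x \<le> y"
  shows "G y \<le> G x"
proof -
  have "G (max a x) = G x" "G (max a y) = G y"
    using const_left[of x] const_left[of y] by (simp_all add: max_def)
  moreover have "G (max a y) \<le> G (max a x)"
  proof (cases "max a x = max a y")
    case False
    then have "max a x < max a y" using max.mono[OF order.refl assms(2)] by (simp only: less_le) simp
    then show ?thesis using strict_left[of "max a y" "max a x"] assms(1) a_neg by (simp add: less_imp_le)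
  qed simp
  ultimately show ?thesis by simp
qed

lemma pos:
  assumes "x \<noteq> 0"
  shows "G 0 < G x"
proof (cases "0 < x")
  case True
  then have "G 0 < G (min b x)" using b_pos by (intro strict_right) auto
  also have "\<dots> \<le> G x" using b_pos True by (intro mono_right) auto
  finally show ?thesis .
next
  case False
  then have "G 0 < G (max a x)" using a_neg assms by (intro strict_left) auto
  also have "\<dots> \<le> G x" using a_neg False by (intro antimono_left) auto
  finally show ?thesis .
qed

text \<open>Strictness makes \<open>y\<close> the extremal point of its side at height at least
  \<open>G x\<close>. Requiring \<open>y\<close> to lie between \<open>a\<close> and
  \<open>b\<close> singles it out, since \<open>G\<close> keeps its end value beyond these
  points.\<close>

lemma opp_eqI:
  assumes "a \<le> y" "y \<le> b" "0 \<le> x \<and> y \<le> 0 \<or> x \<le> 0 \<and> 0 \<le> y" "G y = G x"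
  shows "opp x = y"
proof -
  \<comment> \<open>The point \<open>x = 0\<close> belongs to the first clause of \<open>opp\<close>
    even when the hypothesis supplies \<open>0 \<le> y\<close>; there \<open>pos\<close> forces
    \<open>y = 0\<close>, so the cases match the clauses.\<close>
  consider "0 \<le> x" "y \<le> 0" | "x < 0" "0 \<le> y"
  proof (cases "x = 0")
    case True
    then have "y = 0" using assms(4) pos[of y] by force
    with True show thesis by (intro that(1)) auto
  next
    case False
    with assms(3) have "0 \<le> x \<and> y \<le> 0 \<or> x < 0 \<and> 0 \<le> y" by auto
    with that show thesis by blast
  qed
  then show ?thesis
  proof cases
    case 1
    have "Sup {z. z \<le> 0 \<and> G x \<le> G z} = y"
    proof (rule Sup_eqI)
      fix z assume "z \<in> {z. z \<le> 0 \<and> G x \<le> G z}"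
      then show "z \<le> y" using strict_left[of z y] assms by (force simp: not_le[symmetric])
    qed (use assms 1 in auto)
    then show ?thesis using 1 by (simp add: opp_def)
  next
    case 2
    have "Inf {z. 0 \<le> z \<and> G x \<le> G z} = y"
    proof (rule Inf_eqI)
      fix z assume "z \<in> {z. 0 \<le> z \<and> G x \<le> G z}"
      then show "y \<le> z" using strict_right[of z y] assms by (force simp: not_le[symmetric])
    qed (use assms 2 in auto)
    then show ?thesis using 2 by (simp add: opp_def not_le[symmetric])
  qed
qed

lemma G_le_level: "G x \<le> G b"
proof (cases "0 \<le> x")
  case True
  have "G x \<le> G (max b x)" by (rule mono_right[OF True]) simp
  also have "\<dots> = G b" by (rule const_right) simp
  finally show ?thesis .
next
  case False
  have "G x \<le> G (min a x)" by (rule antimono_left) (use False in auto)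
  also have "\<dots> = G b" using const_left[of "min a x"] level by simp
  finally show ?thesis .
qed

text \<open>Both sides of the well rise from \<open>G 0\<close> to the same maximal height
  \<open>G b\<close>, so the intermediate value theorem yields a point of level \<open>G x\<close>
  on the opposite side; \<open>opp_eqI\<close> identifies it with \<open>opp x\<close>.\<close>

lemma opp_properties:
  shows opp_ge: "a \<le> opp x" and opp_le: "opp x \<le> b" and G_opp: "G (opp x) = G x"
    and opp_nonpos: "0 \<le> x \<Longrightarrow> opp x \<le> 0" and opp_nonneg: "x \<le> 0 \<Longrightarrow> 0 \<le> opp x"
proof -
  have "\<exists>y. a \<le> y \<and> y \<le> b \<and> (if 0 \<le> x then y \<le> 0 else 0 \<le> y) \<and> G y = G x"
  proof (cases "0 \<le> x")
    case True
    have "\<exists>y. a \<le> y \<and> y \<le> 0 \<and> G y = G x"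
      using a_neg G_le_level[of x] level mono_right[OF order.refl True]
      by (intro IVT2' continuous_on_subset[OF cont]) auto
    with True b_pos show ?thesis by (metis less_imp_le order.trans)
  next
    case False
    have "\<exists>y. 0 \<le> y \<and> y \<le> b \<and> G y = G x"
      using b_pos G_le_level[of x] antimono_left[of 0 x] False
      by (intro IVT' continuous_on_subset[OF cont]) auto
    with False a_neg show ?thesis by (metis less_imp_le order.trans)
  qed
  then obtain y where y: "a \<le> y" "y \<le> b" "if 0 \<le> x then y \<le> 0 else 0 \<le> y" "G y = G x" by blast
  then have "opp x = y" by (intro opp_eqI) (auto split: if_splits)
  moreover have "0 \<le> y" if "x \<le> 0"
    using that y pos[of y] by (cases "x = 0") (auto split: if_splits)
  ultimately show "a \<le> opp x" "opp x \<le> b" "G (opp x) = G x"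
    "0 \<le> x \<Longrightarrow> opp x \<le> 0" "x \<le> 0 \<Longrightarrow> 0 \<le> opp x"
    using y by auto
qed

lemma opp_pos: "0 < x \<Longrightarrow> opp x < 0" and opp_neg: "x < 0 \<Longrightarrow> 0 < opp x"
  using opp_nonpos[of x] opp_nonneg[of x] G_opp[of x] pos[of x] by (auto simp: less_le)

lemma opp_zero: "opp 0 = 0"
  using opp_nonpos[of 0] opp_nonneg[of 0] by simp

lemma opp_opp:
  assumes "a \<le> x" "x \<le> b"
  shows "opp (opp x) = x"
proof (rule opp_eqI)
  show "0 \<le> opp x \<and> x \<le> 0 \<or> opp x \<le> 0 \<and> 0 \<le> x"
    using opp_nonpos[of x] opp_nonneg[of x] by (cases "0 \<le> x") auto
qed (rule assms G_opp[symmetric])+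

lemma opp_left:
  assumes "x \<le> a"
  shows "opp x = b"
proof (rule opp_eqI)
  show "G b = G x" by (simp add: const_left[OF assms] level)
  have "x \<le> 0" "0 \<le> b" using assms a_neg b_pos by order+
  then show "0 \<le> x \<and> b \<le> 0 \<or> x \<le> 0 \<and> 0 \<le> b" by blast
qed (rule a_le_b order.refl)+

lemma opp_right:
  assumes "b \<le> x"
  shows "opp x = a"
proof (rule opp_eqI)
  show "G a = G x" by (simp add: const_right[OF assms] level)
  have "0 \<le> x" "a \<le> 0" using assms a_neg b_pos by order+
  then show "0 \<le> x \<and> a \<le> 0 \<or> x \<le> 0 \<and> 0 \<le> a" by blast
qed (rule a_le_b order.refl)+

text \<open>If two points on one side of \<open>0\<close> had images in the same order, monotonicity
  of \<open>G\<close> on the other side would contradict its strictness on the first. For points on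
  different sides, both images would have to be \<open>0\<close>.\<close>

lemma opp_strict_antimono: "strict_antimono_on {a..b} opp"
proof (rule monotone_onI)
  fix x y assume xy: "x \<in> {a..b}" "y \<in> {a..b}" "x < y"
  show "opp y < opp x"
  proof (rule ccontr)
    assume "\<not> opp y < opp x"
    then have le: "opp x \<le> opp y" by simp
    consider "0 \<le> x" | "y \<le> 0" | "x < 0" "0 < y" by force
    then show False
    proof cases
      case 1
      then have "G (opp y) \<le> G (opp x)"
        using antimono_left[OF opp_nonpos le] xy(3) by simp
      with strict_right[OF 1 xy(3)] xy(2) show False by (simp add: G_opp)
    next
      case 2
      then have "G (opp x) \<le> G (opp y)"
        using mono_right[OF opp_nonneg le] xy(3) by simp
      with strict_left[OF 2 xy(3)] xy(1) show False by (simp add: G_opp)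
    next
      case 3
      then have "opp y \<le> 0" "0 \<le> opp x" using opp_nonpos[of y] opp_nonneg[of x] by auto
      with le have "opp x = 0" "opp y = 0" by order+
      then have "x = y" using opp_opp[of x] opp_opp[of y] xy by simp
      with xy(3) show False by simp
    qed
  qed
qed

text \<open>On each half of the extended line \<open>opp\<close> is \<open>G\<close> followed by the
  inverse of \<open>G\<close> on an interval of the other half. That interval is compact, even with
  an infinite end, so the inverse is continuous; the two closed halves are then glued.\<close>

lemma opp_continuous: "continuous_on UNIV opp"
proof -
  have "G x \<in> G ` {a..0}" if "0 \<le> x" for x
    using opp_ge[of x] opp_nonpos[OF that] G_opp[of x] by (intro image_eqI[of _ _ "opp x"]) auto
  then have imageL: "G ` {0..} \<subseteq> G ` {a..0}" by auto
  have "G x \<in> G ` {0..b}" if "x \<le> 0" for x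
    using opp_le[of x] opp_nonneg[OF that] G_opp[of x] by (intro image_eqI[of _ _ "opp x"]) auto
  then have imageR: "G ` {..0} \<subseteq> G ` {0..b}" by auto
  define L where "L = the_inv_into {a..0} G"
  define R where "R = the_inv_into {0..b} G"
  have injL: "inj_on G {a..0}"
    by (rule linorder_inj_onI) (auto dest!: strict_left)
  have injR: "inj_on G {0..b}"
    by (rule linorder_inj_onI) (auto dest!: strict_right)
  have compact: "compact {a..0}" "compact {0..b}"
    by (simp_all add: compact_eq_closed)
  have "continuous_on (G ` {a..0}) L" "continuous_on (G ` {0..b}) R"
    using injL injR compact unfolding L_def R_def
    by (auto intro!: continuous_on_inv continuous_on_subset[OF cont] simp: the_inv_into_f_f)
  then have "continuous_on {0..} (\<lambda>x. L (G x))" "continuous_on {..0} (\<lambda>x. R (G x))"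
    by (auto intro: continuous_on_compose2[OF _ continuous_on_subset[OF cont] imageL]
        continuous_on_compose2[OF _ continuous_on_subset[OF cont] imageR])
  moreover have "L (G x) = opp x" if "0 \<le> x" for x
    unfolding G_opp[of x, symmetric] L_def using opp_ge opp_nonpos that injL
    by (auto simp: the_inv_into_f_f)
  moreover have "R (G x) = opp x" if "x \<le> 0" for x
    unfolding G_opp[of x, symmetric] R_def using opp_le opp_nonneg that injR
    by (auto simp: the_inv_into_f_f)
  ultimately have "continuous_on {0..} opp" "continuous_on {..0} opp"
    by (auto elim: continuous_on_eq)
  then have "continuous_on ({0..} \<union> {..0}) opp"
    by (intro continuous_on_closed_Un) auto
  moreover have "{0..} \<union> {..0} = (UNIV :: ereal set)" by auto
  ultimately show ?thesis by simp
qed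

end

subsection \<open>The function \<open>G\<close> of a measure\<close>

lemma non_atomic_singleton_null:
  assumes "non_atomic M" "{x} \<in> sets M"
  shows "emeasure M {x} = 0"
proof (rule ccontr)
  assume "emeasure M {x} \<noteq> 0"
  then have "atom_of M {x}"
    using assms(2) by (auto simp: atom_of_def subset_singleton_iff zero_less_iff_neq_zero)
  with assms(1) show False by (auto simp: non_atomic_def)
qed

text \<open>Every point outside the support has a null basic open neighbourhood, and a countable
  base has only countably many of these.\<close>

lemma AE_in_supp:
  fixes M :: "'a::second_countable_topology measure"
  assumes "sets M = sets borel"
  shows "AE x in M. x \<in> supp M"
proof -
  obtain B :: "'a set set" where B: "countable B" "topological_basis B"
    using ex_countable_basis by blast
  let ?N = "\<Union>{b \<in> B. emeasure M b = 0}"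
  have "?N \<in> null_sets M"
  proof (rule null_sets_UN'[where N = "\<lambda>b. b", simplified])
    show "countable {b \<in> B. emeasure M b = 0}" using B(1) by simp
  next
    fix b assume b: "b \<in> {b \<in> B. emeasure M b = 0}"
    then have "open b" using topological_basis_open[OF B(2)] by simp
    then show "b \<in> null_sets M" using b assms by (auto simp: null_sets_def)
  qed
  moreover have "{x \<in> space M. x \<notin> supp M} \<subseteq> ?N"
  proof
    fix x assume "x \<in> {x \<in> space M. x \<notin> supp M}"
    then obtain U where U: "open U" "x \<in> U" "emeasure M U = 0"
      by (auto simp: supp_def zero_less_iff_neq_zero)
    then obtain b where b: "b \<in> B" "x \<in> b" "b \<subseteq> U"
      using topological_basisE[OF B(2)] by blast
    have "emeasure M b \<le> emeasure M U" by (rule emeasure_mono) (use b U assms in auto)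
    with b U show "x \<in> ?N" by auto
  qed
  ultimately show ?thesis by (rule AE_I')
qed

text \<open>One of the two sets in the union is empty, depending on the sign of \<open>x\<close>.
  With \<open>\<bar>z\<bar>\<close> as integrand this merges the two clauses of \<open>Gfun\<close>
  into a single integral.\<close>

definition segment0 :: "ereal \<Rightarrow> real set" where
  "segment0 x = {z. 0 < z \<and> ereal z \<le> x} \<union> {z. x \<le> ereal z \<and> z < 0}"

lemma segment0_borel [measurable]: "segment0 x \<in> sets borel"
  unfolding segment0_def by measurable

lemma segment0_nonneg_iff: "0 \<le> x \<Longrightarrow> z \<in> segment0 x \<longleftrightarrow> 0 < z \<and> ereal z \<le> x"
  and segment0_nonpos_iff: "x \<le> 0 \<Longrightarrow> z \<in> segment0 x \<longleftrightarrow> z < 0 \<and> x \<le> ereal z"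
  unfolding segment0_def
  using order.trans[of 0 x "ereal z"] order.trans[of "ereal z" x 0] by auto

lemma Gfun_eq: "Gfun \<mu> x = (LINT z|\<mu>. indicator (segment0 x) z * \<bar>z\<bar>)"
proof (cases "0 \<le> x")
  case True
  then have "(LINT z:{z. 0 < z \<and> ereal z \<le> x}|\<mu>. z) = (LINT z|\<mu>. indicator (segment0 x) z * \<bar>z\<bar>)"
    unfolding set_lebesgue_integral_def
    by (intro Bochner_Integration.integral_cong) (auto simp: segment0_nonneg_iff indicator_def)
  with True show ?thesis by (simp add: Gfun_def)
next
  case False
  then have "(LINT z:{z. x \<le> ereal z \<and> z < 0}|\<mu>. - z) = (LINT z|\<mu>. indicator (segment0 x) z * \<bar>z\<bar>)"
    unfolding set_lebesgue_integral_def
    by (intro Bochner_Integration.integral_cong) (auto simp: segment0_nonpos_iff indicator_def)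
  with False show ?thesis by (simp only: Gfun_def if_False)
qed

locale first_moment = finite_measure \<mu> for \<mu> :: "real measure" +
  assumes sets_borel [measurable_cong]: "sets \<mu> = sets borel"
    and first_moment: "integrable \<mu> (\<lambda>z. z)"
begin

lemma space_UNIV [simp]: "space \<mu> = UNIV"
  using sets_eq_imp_space_eq[OF sets_borel] by simp

lemma integrable_segment0 [intro]: "integrable \<mu> (\<lambda>z. indicator (segment0 x) z * \<bar>z\<bar>)"
  by (rule Bochner_Integration.integrable_bound[OF first_moment]) (auto simp: indicator_def)

text \<open>Dominated convergence with bound \<open>\<bar>z\<bar>\<close>: unless \<open>z\<close>
  is the limit point, it eventually lies in \<open>segment0 (u n)\<close> exactly when it lies in
  \<open>segment0 x\<close>.\<close>

lemma continuous_on_Gfun: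
  assumes null: "\<And>x. emeasure \<mu> {x} = 0"
  shows "continuous_on UNIV (Gfun \<mu>)"
proof (rule continuous_on_sequentiallyI)
  fix u :: "nat \<Rightarrow> ereal" and x assume u: "u \<longlonglongrightarrow> x"
  \<comment> \<open>For infinite \<open>x\<close> this excludes \<open>0\<close>, the default value
    of \<open>real_of_ereal\<close>, which is a null point like any other.\<close>
  have "AE z in \<mu>. z \<noteq> real_of_ereal x"
    by (rule AE_I[where N = "{real_of_ereal x}"]) (use null sets_borel in auto)
  then have "AE z in \<mu>. (\<lambda>n. indicator (segment0 (u n)) z * \<bar>z\<bar>)
      \<longlonglongrightarrow> indicator (segment0 x) z * \<bar>z\<bar>"
  proof eventually_elim
    fix z assume "z \<noteq> real_of_ereal x"
    then have "ereal z < x \<or> x < ereal z" by (metis linorder_neqE real_of_ereal.simps(1))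
    then have "\<forall>\<^sub>F n in sequentially. z \<in> segment0 (u n) \<longleftrightarrow> z \<in> segment0 x"
    proof
      assume "ereal z < x"
      with order_tendstoD(1)[OF u] have "\<forall>\<^sub>F n in sequentially. ereal z < u n" by auto
      then show ?thesis
        by eventually_elim (use \<open>ereal z < x\<close> in \<open>auto simp: segment0_def not_le[symmetric]\<close>)
    next
      assume "x < ereal z"
      with order_tendstoD(2)[OF u] have "\<forall>\<^sub>F n in sequentially. u n < ereal z" by auto
      then show ?thesis
        by eventually_elim (use \<open>x < ereal z\<close> in \<open>auto simp: segment0_def not_le[symmetric]\<close>)
    qed
    then show "(\<lambda>n. indicator (segment0 (u n)) z * \<bar>z\<bar>) \<longlonglongrightarrow> indicator (segment0 x) z * \<bar>z\<bar>"
      by (intro tendsto_eventually) (auto elim: eventually_mono simp: indicator_def)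
  qed
  then have "(\<lambda>n. LINT z|\<mu>. indicator (segment0 (u n)) z * \<bar>z\<bar>)
      \<longlonglongrightarrow> (LINT z|\<mu>. indicator (segment0 x) z * \<bar>z\<bar>)"
  proof (rule integral_dominated_convergence[where w = "\<lambda>z. \<bar>z\<bar>", rotated 3])
    show "integrable \<mu> (\<lambda>z. \<bar>z\<bar>)" using first_moment by simp
  qed (auto simp: indicator_def)
  then show "(\<lambda>n. Gfun \<mu> (u n)) \<longlonglongrightarrow> Gfun \<mu> x" by (simp add: Gfun_eq)
qed

text \<open>An open set meeting the support has positive measure, and on \<open>U\<close> the larger
  integrand exceeds the smaller one.\<close>

lemma Gfun_less:
  assumes "segment0 x \<subseteq> segment0 y" "open U" "U \<subseteq> segment0 y - segment0 x" "U \<inter> supp \<mu> \<noteq> {}"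
  shows "Gfun \<mu> x < Gfun \<mu> y"
proof -
  have "emeasure \<mu> U \<noteq> 0" using assms(2,4) by (force simp: supp_def)
  then show ?thesis
    unfolding Gfun_eq
  proof (rule integral_less_AE[OF integrable_segment0 integrable_segment0, where A = U])
    show "AE z in \<mu>. z \<in> U \<longrightarrow>
        indicator (segment0 x) z * \<bar>z\<bar> \<noteq> indicator (segment0 y) z * \<bar>z\<bar>"
      using assms(3) by (auto simp: indicator_def segment0_def)
    show "AE z in \<mu>. indicator (segment0 x) z * \<bar>z\<bar> \<le> indicator (segment0 y) z * \<bar>z\<bar>"
      using assms(1) by (auto simp: indicator_def)
  qed (use assms(2) sets_borel in auto)
qed

lemma Gfun_cong_supp:
  assumes "segment0 x \<inter> supp \<mu> = segment0 y \<inter> supp \<mu>"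
  shows "Gfun \<mu> x = Gfun \<mu> y"
  unfolding Gfun_eq
proof (rule integral_cong_AE)
  show "AE z in \<mu>. indicator (segment0 x) z * \<bar>z\<bar> = indicator (segment0 y) z * \<bar>z\<bar>"
    using AE_in_supp[OF sets_borel] by eventually_elim (use assms in \<open>auto simp: indicator_def\<close>)
qed auto

text \<open>Positive part minus negative part of \<open>z\<close>; through this identity mean zero
  becomes equality of the two end heights of \<open>G\<close>.\<close>

lemma Gfun_infinity_diff: "Gfun \<mu> \<infinity> - Gfun \<mu> (-\<infinity>) = (LINT z|\<mu>. z)"
proof -
  have "Gfun \<mu> \<infinity> - Gfun \<mu> (-\<infinity>)
      = (LINT z|\<mu>. indicator (segment0 \<infinity>) z * \<bar>z\<bar> - indicator (segment0 (-\<infinity>)) z * \<bar>z\<bar>)"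
    unfolding Gfun_eq by (rule Bochner_Integration.integral_diff[symmetric]) auto
  also have "\<dots> = (LINT z|\<mu>. z)"
    by (rule Bochner_Integration.integral_cong) (auto simp: indicator_def segment0_def)
  finally show ?thesis .
qed

end

lemma potential_well_Gfun:
  fixes \<mu> :: "real measure"
  assumes "a < 0" "0 < b" "prob_space \<mu>" "sets \<mu> = sets borel" "\<And>x. emeasure \<mu> {x} = 0" "zero_mean \<mu>"
    and supp: "supp \<mu> = {x. a \<le> ereal x \<and> ereal x \<le> b}"
  shows "potential_well a b (Gfun \<mu>)"
proof -
  interpret prob_space \<mu> by fact
  interpret first_moment \<mu> by standard (use assms in \<open>auto simp: zero_mean_def\<close>)
  \<comment> \<open>These intervals play the role of \<open>U\<close> in \<open>Gfun_less\<close>.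
    Density of the reals in the extended line provides a support point in each, also when an
    endpoint is infinite.\<close>
  have dense: "open {z. x < ereal z \<and> ereal z < y} \<and> {z. x < ereal z \<and> ereal z < y} \<inter> supp \<mu> \<noteq> {}"
    if xy: "x < y" "a \<le> x" "y \<le> b" for x y
  proof
    have "{z. x < ereal z \<and> ereal z < y} = ereal -` {x<..<y}" by auto
    then show "open {z. x < ereal z \<and> ereal z < y}"
      by (simp add: open_vimage continuous_on_ereal continuous_on_id)
    obtain z where "x < ereal z" "ereal z < y" using ereal_dense2[OF xy(1)] by blast
    with xy show "{z. x < ereal z \<and> ereal z < y} \<inter> supp \<mu> \<noteq> {}"
      unfolding supp by (force intro: less_imp_le)
  qed
  have right: "Gfun \<mu> x = Gfun \<mu> b" if "b \<le> x" for x
  proof (rule Gfun_cong_supp)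
    have "0 \<le> x" using that assms(2) by order
    then show "segment0 x \<inter> supp \<mu> = segment0 b \<inter> supp \<mu>"
      using that assms(2) by (auto simp: supp segment0_nonneg_iff)
  qed
  have left: "Gfun \<mu> x = Gfun \<mu> a" if "x \<le> a" for x
  proof (rule Gfun_cong_supp)
    have "x \<le> 0" using that assms(1) by order
    then show "segment0 x \<inter> supp \<mu> = segment0 a \<inter> supp \<mu>"
      using that assms(1) by (auto simp: supp segment0_nonpos_iff)
  qed
  show ?thesis
  proof
    show "Gfun \<mu> x < Gfun \<mu> y" if xy: "0 \<le> x" "x < y" "y \<le> b" for x y
    proof (rule Gfun_less)
      have "0 \<le> y" "a \<le> x" using xy assms(1) by order+
      note iff = segment0_nonneg_iff[OF xy(1)] segment0_nonneg_iff[OF \<open>0 \<le> y\<close>]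
      show "segment0 x \<subseteq> segment0 y"
      proof
        fix z assume "z \<in> segment0 x"
        moreover from this have "ereal z \<le> x" unfolding iff by simp
        with xy have "ereal z \<le> y" by order
        ultimately show "z \<in> segment0 y" unfolding iff by simp
      qed
      show "{z. x < ereal z \<and> ereal z < y} \<subseteq> segment0 y - segment0 x"
      proof
        fix z assume z: "z \<in> {z. x < ereal z \<and> ereal z < y}"
        then have "ereal 0 < ereal z" using xy(1) le_less_trans[of 0 x "ereal z"] by simp
        with z show "z \<in> segment0 y - segment0 x" by (simp add: iff not_le[symmetric] less_imp_le)
      qed
      show "open {z. x < ereal z \<and> ereal z < y}" "{z. x < ereal z \<and> ereal z < y} \<inter> supp \<mu> \<noteq> {}"
        using dense xy \<open>a \<le> x\<close> by auto
    qed
    show "Gfun \<mu> y < Gfun \<mu> x" if xy: "y \<le> 0" "x < y" "a \<le> x" for x y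
    proof (rule Gfun_less)
      have "x \<le> 0" "y \<le> b" using xy assms(2) by order+
      note iff = segment0_nonpos_iff[OF xy(1)] segment0_nonpos_iff[OF \<open>x \<le> 0\<close>]
      show "segment0 y \<subseteq> segment0 x"
      proof
        fix z assume "z \<in> segment0 y"
        moreover from this have "y \<le> ereal z" unfolding iff by simp
        with xy have "x \<le> ereal z" by order
        ultimately show "z \<in> segment0 x" unfolding iff by simp
      qed
      show "{z. x < ereal z \<and> ereal z < y} \<subseteq> segment0 x - segment0 y"
      proof
        fix z assume z: "z \<in> {z. x < ereal z \<and> ereal z < y}"
        then have "ereal z < ereal 0" using xy(1) less_le_trans[of "ereal z" y 0] by simp
        with z show "z \<in> segment0 x - segment0 y" by (simp add: iff not_le[symmetric] less_imp_le)
      qed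
      show "open {z. x < ereal z \<and> ereal z < y}" "{z. x < ereal z \<and> ereal z < y} \<inter> supp \<mu> \<noteq> {}"
        using dense xy \<open>y \<le> b\<close> by auto
    qed
    show "continuous_on UNIV (Gfun \<mu>)" by (rule continuous_on_Gfun) fact
    show "Gfun \<mu> x = Gfun \<mu> b" if "b \<le> x" for x by (rule right) fact
    show "Gfun \<mu> x = Gfun \<mu> a" if "x \<le> a" for x by (rule left) fact
    \<comment> \<open>The end heights are the values at the infinite points, whose difference is the
      mean.\<close>
    show "Gfun \<mu> a = Gfun \<mu> b"
      using right[of \<infinity>] left[of "-\<infinity>"] Gfun_infinity_diff assms(6) by (simp add: zero_mean_def)
  qed (fact assms)+
qed

lemma reciprocating_eq_opp:
  assumes "potential_well a b (Gfun \<mu>)"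
  shows "reciprocating \<mu> = potential_well.opp (Gfun \<mu>)"
  by (simp add: fun_eq_iff reciprocating_def potential_well.opp_def[OF assms] x_minus_def x_plus_def)

subsection \<open>Smoothness of the reciprocating function at the origin\<close>

text \<open>Caratheodory's form \<open>H z - H (g x) = q z * (z - g x)\<close> turns the difference
  quotient of \<open>g\<close> into that of \<open>K\<close> divided by \<open>q (g y)\<close>, so
  continuity of \<open>g\<close> at \<open>x\<close> already yields differentiability.\<close>

lemma has_real_derivative_implicit:
  fixes g H :: "real \<Rightarrow> real"
  assumes g: "isCont g x" and H: "(H has_real_derivative D) (at (g x))" "D \<noteq> 0"
    and K: "(K has_real_derivative E) (at x)"
    and eq: "\<forall>\<^sub>F y in nhds x. H (g y) = K y"
  shows "(g has_real_derivative E / D) (at x)"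
proof -
  obtain q where q: "\<And>z. H z - H (g x) = q z * (z - g x)" "isCont q (g x)" "q (g x) = D"
    using H(1) by (auto simp: CARAT_DERIV)
  have qg: "((\<lambda>y. q (g y)) \<longlongrightarrow> D) (at x)"
    using isCont_o2[OF g q(2)] q(3) by (simp add: isCont_def)
  have "((\<lambda>y. (K y - K x) / (y - x) / q (g y)) \<longlongrightarrow> E / D) (at x)"
    using K qg H(2) by (intro tendsto_divide) (auto simp: has_field_derivative_iff)
  moreover have "\<forall>\<^sub>F y in at x. (K y - K x) / (y - x) / q (g y) = (g y - g x) / (y - x)"
  proof -
    have eqx: "H (g x) = K x" using eq by (rule eventually_nhds_x_imp_x)
    have "\<forall>\<^sub>F y in at x. q (g y) \<noteq> 0"
      using qg H(2) by (rule tendsto_imp_eventually_ne)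
    moreover have "\<forall>\<^sub>F y in at x. H (g y) = K y"
      using eq by (rule eventually_at_filter[THEN iffD2, OF eventually_mono]) simp
    ultimately show ?thesis
      by eventually_elim (use q(1) eqx in \<open>simp add: divide_simps\<close>, metis mult.commute)
  qed
  ultimately show ?thesis
    unfolding has_field_derivative_iff by (rule Lim_transform_eventually)
qed

text \<open>Near \<open>0\<close> the density turns \<open>Gfun\<close> into the integral of
  \<open>z * p z\<close> from \<open>0\<close> to \<open>x\<close>, to which the fundamental theorem
  of calculus applies.\<close>

lemma (in first_moment) Gfun_derivative:
  assumes p: "continuous_on {-d<..<d} p" "\<And>x. x \<in> {-d<..<d} \<Longrightarrow> 0 < p x"
    and dens: "\<And>A. A \<in> sets borel \<Longrightarrow> A \<subseteq> {-d<..<d} \<Longrightarrow>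
      emeasure \<mu> A = (\<integral>\<^sup>+x\<in>A. ennreal (p x) \<partial>lborel)"
    and x: "x \<in> {-d<..<d}"
  shows "((\<lambda>x. Gfun \<mu> (ereal x)) has_real_derivative x * p x) (at x)"
proof -
  let ?S = "{-d<..<d}"
  have [measurable]: "(\<lambda>x. indicator ?S x * p x) \<in> borel_measurable borel"
    using borel_measurable_continuous_on_indicator[OF _ p(1)] by simp
  \<comment> \<open>Lifting \<open>dens\<close> from sets to an equality of measures makes it usable
    for integrals over \<open>?S\<close>.\<close>
  have eq: "density \<mu> (\<lambda>x. ennreal (indicator ?S x)) = density lborel (\<lambda>x. ennreal (indicator ?S x * p x))"
  proof (rule measure_eqI)
    fix A assume "A \<in> sets (density \<mu> (\<lambda>x. ennreal (indicator ?S x)))"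
    then have A[measurable]: "A \<in> sets borel" using sets_borel by simp
    have "emeasure (density \<mu> (\<lambda>x. ennreal (indicator ?S x))) A = emeasure \<mu> (?S \<inter> A)"
      using A sets_borel by (simp only: ennreal_indicator) (intro emeasure_restricted, auto)
    also have "\<dots> = (\<integral>\<^sup>+x\<in>?S \<inter> A. ennreal (p x) \<partial>lborel)"
      by (rule dens) auto
    also have "\<dots> = emeasure (density lborel (\<lambda>x. ennreal (indicator ?S x * p x))) A"
      using A by (subst emeasure_density)
        (measurable, auto intro!: nn_integral_cong simp: indicator_def)
    finally show "emeasure (density \<mu> (\<lambda>x. ennreal (indicator ?S x))) A
      = emeasure (density lborel (\<lambda>x. ennreal (indicator ?S x * p x))) A" .
  qed (simp add: sets_borel)
  have local: "(LINT z|\<mu>. indicator ?S z * f z) = (LINT z|lborel. indicator ?S z * p z * f z)"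
    if [measurable]: "f \<in> borel_measurable borel" for f :: "real \<Rightarrow> real"
  proof -
    have "(LINT z|\<mu>. indicator ?S z * f z) = (LINT z|density \<mu> (\<lambda>x. ennreal (indicator ?S x)). f z)"
      by (subst integral_density) auto
    also have "\<dots> = (LINT z|lborel. indicator ?S z * p z * f z)"
      unfolding eq
    proof (subst integral_density)
      show "AE x in lborel. 0 \<le> indicator ?S x * p x"
        using p(2) by (auto simp: indicator_def less_imp_le)
    qed auto
    finally show ?thesis .
  qed
  \<comment> \<open>The oriented integral takes care of the sign: for \<open>u < 0\<close> the
    reversal of the endpoints cancels the minus in \<open>\<bar>z\<bar> = - z\<close>.\<close>
  have Gfun_interval: "Gfun \<mu> (ereal u) = (LBINT z=0..u. z * p z)" if u: "u \<in> ?S" for u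
  proof -
    have "Gfun \<mu> (ereal u) = (LINT z|\<mu>. indicator ?S z * (indicator (segment0 (ereal u)) z * \<bar>z\<bar>))"
      unfolding Gfun_eq using u by (intro Bochner_Integration.integral_cong)
        (auto simp: indicator_def segment0_def)
    also have "\<dots> = (LINT z|lborel. indicator ?S z * p z * (indicator (segment0 (ereal u)) z * \<bar>z\<bar>))"
      by (rule local) measurable
    also have "\<dots> = (LBINT z=0..u. z * p z)"
    proof (cases "0 \<le> u")
      case True
      then have "(LBINT z=0..u. z * p z) = (LINT z:{0<..u}|lborel. z * p z)"
        using interval_integral_Ioc[of 0 u] by (simp add: zero_ereal_def)
      also have "\<dots> = (LINT z|lborel. indicator ?S z * p z * (indicator (segment0 (ereal u)) z * \<bar>z\<bar>))"
        unfolding set_lebesgue_integral_def using u True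
        by (intro Bochner_Integration.integral_cong) (auto simp: indicator_def segment0_def)
      finally show ?thesis ..
    next
      case False
      then have "(LBINT z=0..u. z * p z) = - (LINT z:{u..<0}|lborel. z * p z)"
        using interval_integral_Ico[of u 0 "\<lambda>z. z * p z"]
          interval_integral_endpoints_reverse[of 0 "ereal u" "\<lambda>z. z * p z"]
        by (simp add: zero_ereal_def)
      also have "\<dots> = (LINT z|lborel. - (indicator {u..<0} z * (z * p z)))"
        unfolding set_lebesgue_integral_def by simp
      also have "\<dots> = (LINT z|lborel. indicator ?S z * p z * (indicator (segment0 (ereal u)) z * \<bar>z\<bar>))"
        using u False
        by (intro Bochner_Integration.integral_cong) (auto simp: indicator_def segment0_def)
      finally show ?thesis ..
    qed
    finally show ?thesis .
  qed
  \<comment> \<open>The fundamental theorem is applied on the compact interval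
    \<open>{-e..e}\<close>, which has \<open>x\<close> in its interior and lies inside the domain of
    continuity of \<open>p\<close>.\<close>
  obtain e where e: "\<bar>x\<bar> < e" "e < d" using x by (meson abs_less_iff dense greaterThanLessThan_iff minus_less_iff)
  have "((\<lambda>u. LBINT z=ereal 0..ereal u. z * p z) has_vector_derivative x * p x) (at x within {-e..e})"
    using e by (intro interval_integral_FTC2 continuous_intros continuous_on_subset[OF p(1)]) auto
  moreover have "at x within {-e..e} = at x" using e by (intro at_within_interior) auto
  ultimately have "((\<lambda>u. LBINT z=0..u. z * p z) has_real_derivative x * p x) (at x)"
    unfolding has_real_derivative_iff_has_vector_derivative zero_ereal_def by (simp only:)
  moreover have "\<forall>\<^sub>F u in nhds x. Gfun \<mu> (ereal u) = (LBINT z=0..u. z * p z)"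
    using x Gfun_interval by (intro eventually_nhds_in_open[THEN eventually_mono, of ?S]) auto
  ultimately show ?thesis by (subst DERIV_cong_ev[OF refl _ refl])
qed

text \<open>Away from \<open>0\<close> the equation \<open>H (g x) = H x\<close> can be
  differentiated implicitly. At \<open>0\<close> the derivative of \<open>H\<close> vanishes, and
  the quadratic behaviour of \<open>H\<close> takes over.\<close>

lemma (in potential_well) cont_diff_opp:
  assumes "0 < d" and p: "continuous_on {-d<..<d} p" "\<And>x. x \<in> {-d<..<d} \<Longrightarrow> 0 < p x"
    and deriv: "\<And>x. x \<in> {-d<..<d} \<Longrightarrow> ((\<lambda>x. G (ereal x)) has_real_derivative x * p x) (at x)"
  shows "cont_diff_near_0 opp"
proof -
  define H where "H x = G (ereal x) - G 0" for x
  define g where "g x = real_of_ereal (opp (ereal x))" for x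
  let ?S = "{-d<..<d}"
  have derivH: "(H has_real_derivative x * p x) (at x)" if "x \<in> ?S" for x
    unfolding H_def using deriv[OF that] by (auto intro!: derivative_eq_intros)
  have "continuous_on UNIV (\<lambda>x. opp (ereal x))"
    by (rule continuous_on_compose2[OF opp_continuous]) (auto intro: continuous_on_ereal continuous_on_id)
  then have cont_opp: "isCont (\<lambda>x. opp (ereal x)) x" for x
    by (simp add: continuous_on_eq_continuous_at)
  have "((\<lambda>x. opp (ereal x)) \<longlongrightarrow> opp (ereal 0)) (nhds 0)"
    by (rule tendsto_at_iff_tendsto_nhds[THEN iffD1, OF cont_opp[of 0, unfolded isCont_def]])
  then have "((\<lambda>x. opp (ereal x)) \<longlongrightarrow> 0) (nhds 0)"
    by (simp only: opp_zero flip: zero_ereal_def)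
  \<comment> \<open>Close to \<open>0\<close> the values of \<open>opp\<close> are finite and stay
    where \<open>p\<close> is positive and continuous, so \<open>g\<close> represents
    \<open>opp\<close> and \<open>p (g x)\<close> is under control.\<close>
  then have "\<forall>\<^sub>F x in nhds 0. ereal (-d) < opp (ereal x) \<and> opp (ereal x) < ereal d"
    using \<open>0 < d\<close> by (intro eventually_conj) (simp_all add: order_tendstoD)
  then obtain e' where e': "0 < e'" "\<And>x. \<bar>x\<bar> < e' \<Longrightarrow> ereal (-d) < opp (ereal x) \<and> opp (ereal x) < ereal d"
    by (auto simp: eventually_nhds_metric dist_real_def)
  define e where "e = min d e'"
  let ?T = "{-e<..<e}"
  have e: "0 < e" "?T \<subseteq> ?S" using e' \<open>0 < d\<close> by (auto simp: e_def)
  have opp_g: "opp (ereal x) = ereal (g x)" and g_S: "g x \<in> ?S" if "x \<in> ?T" for x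
  proof -
    have "\<bar>x\<bar> < e'" using that by (auto simp: e_def)
    from e'(2)[OF this] show "opp (ereal x) = ereal (g x)" "g x \<in> ?S"
      by (cases "opp (ereal x)"; simp add: g_def)+
  qed
  have T: "\<forall>\<^sub>F y in nhds x. y \<in> ?T" if "x \<in> ?T" for x
    using that by (intro eventually_nhds_in_open) auto
  have g0: "g 0 = 0" by (simp add: g_def opp_zero flip: zero_ereal_def)
  have Hg: "H (g x) = H x" if "x \<in> ?T" for x
    by (simp add: H_def G_opp flip: opp_g[OF that])
  have sign: "g x / x < 0" if "x \<in> ?T" "x \<noteq> 0" for x
    using opp_pos[of "ereal x"] opp_neg[of "ereal x"] opp_g[OF that(1)] that(2)
    by (cases x "0 :: real" rule: linorder_cases) (auto simp: divide_less_0_iff)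
  then have g_nz: "g x \<noteq> 0" if "x \<in> ?T" "x \<noteq> 0" for x using that by force
  have cont_g: "isCont g x" if "x \<in> ?T" for x
  proof -
    have "((\<lambda>y. opp (ereal y)) \<longlongrightarrow> ereal (g x)) (at x)"
      using cont_opp[of x] unfolding isCont_def opp_g[OF that] .
    from lim_real_of_ereal[OF this] show ?thesis unfolding isCont_def g_def[symmetric] .
  qed
  have cont_p: "isCont p x" if "x \<in> ?S" for x
    using p(1) that by (simp add: continuous_on_eq_continuous_at)
  have p0: "0 < p 0" using p(2) \<open>0 < d\<close> by simp
  have ev0: "\<forall>\<^sub>F x in at 0. x \<in> ?T \<and> x \<noteq> 0"
    using T[of 0] e by (auto simp: eventually_at_filter elim: eventually_mono)
  have quad: "((\<lambda>x. H x / x^2) \<longlongrightarrow> p 0 / 2) (at 0)"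
  proof (rule lhopital)
    show "(H \<longlongrightarrow> 0) (at 0)"
      using DERIV_isCont[OF derivH[of 0]] \<open>0 < d\<close> by (simp add: isCont_def H_def zero_ereal_def)
    show "\<forall>\<^sub>F x in at 0. (H has_real_derivative x * p x) (at x)"
      using ev0 by eventually_elim (use e derivH in blast)
    have "((\<lambda>x. p x / 2) \<longlongrightarrow> p 0 / 2) (at 0)"
      using cont_p[of 0] \<open>0 < d\<close> by (auto intro!: tendsto_intros simp: isCont_def)
    then show "((\<lambda>x. x * p x / (2 * x)) \<longlongrightarrow> p 0 / 2) (at 0)"
      by (rule Lim_transform_eventually) (simp add: eventually_at_filter)
    have "((\<lambda>x. x^2) has_real_derivative 2 * x) (at x)" for x :: real
      by (auto intro!: derivative_eq_intros)
    then show "\<forall>\<^sub>F x in at 0. ((\<lambda>x. x^2) has_real_derivative 2 * x) (at x)"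
      by (intro always_eventually allI)
  qed (auto intro!: tendsto_eq_intros simp: eventually_at_filter)
  have g_at: "filterlim g (at 0) (at 0)"
    using cont_g[of 0] e g0 ev0 g_nz by (auto simp: filterlim_at isCont_def elim: eventually_mono)
  \<comment> \<open>As \<open>H (g x) = H x\<close>, the square of \<open>g x / x\<close> is a
    quotient of two instances of \<open>quad\<close> and tends to \<open>1\<close>; \<open>g\<close>
    changes sides, which selects the negative root.\<close>
  have ratio: "((\<lambda>x. g x / x) \<longlongrightarrow> - 1) (at 0)"
  proof -
    have "((\<lambda>x. - sqrt ((H x / x^2) / (H (g x) / (g x)^2))) \<longlongrightarrow> - sqrt ((p 0 / 2) / (p 0 / 2))) (at 0)"
      using p0 by (intro tendsto_intros quad filterlim_compose[OF quad g_at]) auto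
    moreover have "\<forall>\<^sub>F x in at 0. - sqrt ((H x / x^2) / (H (g x) / (g x)^2)) = g x / x"
      using ev0
    proof eventually_elim
      case (elim x)
      have "H x \<noteq> 0" using pos[of "ereal x"] elim by (auto simp: H_def)
      then have "(H x / x^2) / (H (g x) / (g x)^2) = (g x / x)^2"
        using elim g_nz[of x] by (simp add: Hg power_divide)
      then have "sqrt ((H x / x^2) / (H (g x) / (g x)^2)) = \<bar>g x / x\<bar>"
        by (simp only: real_sqrt_abs)
      moreover have "g x / x < 0" using sign elim by blast
      ultimately show ?case by (simp only: abs_of_neg minus_minus)
    qed
    ultimately show ?thesis using p0 by (auto intro: Lim_transform_eventually)
  qed
  \<comment> \<open>The value at \<open>0\<close> comes from \<open>ratio\<close>; the second branch
    would evaluate there to \<open>0 / 0 = 0\<close>.\<close>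
  define D where "D x = (if x = 0 then - 1 else x * p x / (g x * p (g x)))" for x
  have derivg: "(g has_real_derivative D x) (at x)" if x: "x \<in> ?T" for x
  proof (cases "x = 0")
    case True
    then show ?thesis using ratio by (simp add: D_def has_field_derivative_iff g0)
  next
    case False
    have "(g has_real_derivative x * p x / (g x * p (g x))) (at x)"
    proof (rule has_real_derivative_implicit[where H = H and K = H])
      show "g x * p (g x) \<noteq> 0" using p(2)[OF g_S[OF x]] g_nz[OF x False] by simp
      show "\<forall>\<^sub>F y in nhds x. H (g y) = H y" using T[OF x] by eventually_elim (rule Hg)
    qed (use x g_S e derivH cont_g in auto)
    then show ?thesis using False by (simp add: D_def)
  qed
  have "isCont D x" if x: "x \<in> ?T" for x
  proof -
    have pg: "isCont (\<lambda>y. p (g y)) x"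
      by (rule isCont_o2[OF cont_g[OF x] cont_p[OF g_S[OF x]]])
    have px: "isCont p x" using cont_p x e by blast
    have pgx: "p (g x) \<noteq> 0" using p(2)[OF g_S[OF x]] by simp
    show ?thesis
    proof (cases "x = 0")
      case True
      \<comment> \<open>Dividing by \<open>y\<close> expresses \<open>D\<close> through
        \<open>g y / y\<close>, whose limit is known; with \<open>g 0 = 0\<close> the limit of
        \<open>D\<close> is \<open>- 1\<close>.\<close>
      have "((\<lambda>y. p y / p (g y) / (g y / y)) \<longlongrightarrow> p 0 / p (g 0) / (- 1)) (at 0)"
        using px pg pgx True by (intro tendsto_intros ratio) (auto simp: isCont_def)
      moreover have "\<forall>\<^sub>F y in at 0. p y / p (g y) / (g y / y) = D y"
        by (simp add: eventually_at_filter D_def mult.commute)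
      ultimately have "(D \<longlongrightarrow> p 0 / p (g 0) / (- 1)) (at 0)" by (rule Lim_transform_eventually)
      then show ?thesis using True p0 g0 by (simp add: isCont_def D_def)
    next
      case False
      have "isCont (\<lambda>y. y * p y / (g y * p (g y))) x"
        using pg px cont_g[OF x] pgx g_nz[OF x False] by (intro continuous_intros) auto
      moreover have "\<forall>\<^sub>F y in nhds x. D y = y * p y / (g y * p (g y))"
        using t1_space_nhds[OF False] by eventually_elim (simp add: D_def)
      ultimately show ?thesis by (simp add: isCont_cong)
    qed
  qed
  then have "continuous_on ?T D" by (simp add: continuous_at_imp_continuous_on)
  moreover have "has_finite_derivative_at opp (D x) x" if "x \<in> ?T" for x
    unfolding has_finite_derivative_at_def
    using derivg[OF that] T[OF that] opp_g by (auto intro!: exI[of _ g] elim: eventually_mono)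
  ultimately show ?thesis
    unfolding cont_diff_near_0_def using e by (intro exI[of _ ?T] exI[of _ D]) auto
qed

text \<open>Differentiating \<open>f (f y) = y\<close> at the fixed point gives
  \<open>D * D = 1\<close>, and a decreasing function cannot have derivative
  \<open>1\<close>.\<close>

lemma derivative_of_involution_at_fixed_point:
  fixes r :: "ereal \<Rightarrow> ereal"
  assumes ab: "a < 0" "0 < b" and r0: "r 0 = 0" and mono: "strict_antimono_on {a..b} r"
    and inv: "\<forall>x\<in>{a..b}. r (r x) = x" and diff: "cont_diff_near_0 r"
  shows "has_finite_derivative_at r (- 1) 0"
proof -
  obtain D where "has_finite_derivative_at r D 0"
    using diff by (auto simp: cont_diff_near_0_def)
  then obtain f where f: "\<forall>\<^sub>F y in nhds 0. r (ereal y) = ereal (f y)" "(f has_real_derivative D) (at 0)"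
    by (auto simp: has_finite_derivative_at_def)
  have f0: "f 0 = 0"
    using eventually_nhds_x_imp_x[OF f(1)] r0 by (simp flip: zero_ereal_def)
  have "((\<lambda>y. ereal y) \<longlongrightarrow> 0) (nhds 0)"
    by (simp add: zero_ereal_def filterlim_ident)
  then have in_ab: "\<forall>\<^sub>F y in nhds 0. a < ereal y \<and> ereal y < b"
    using ab by (intro eventually_conj) (simp_all add: order_tendstoD)
  have "(f \<longlongrightarrow> 0) (nhds 0)"
    using DERIV_isCont[OF f(2)] f0 tendsto_at_iff_tendsto_nhds[of f 0] by (simp add: isCont_def)
  then have "\<forall>\<^sub>F y in nhds 0. r (ereal (f y)) = ereal (f (f y))"
    by (rule eventually_compose_filterlim[OF f(1)])
  with f(1) in_ab have "\<forall>\<^sub>F y in nhds 0. f (f y) = y"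
  proof eventually_elim
    case (elim y)
    then have "r (r (ereal y)) = ereal y" using bspec[OF inv, of "ereal y"] by (simp add: less_imp_le)
    with elim show ?case by simp
  qed
  moreover have "((\<lambda>y. f (f y)) has_real_derivative D * D) (at 0)"
    using f(2) by (intro DERIV_chain2[of f]) (simp_all add: f0)
  ultimately have "((\<lambda>y. y) has_real_derivative D * D) (at 0)"
    by (subst (asm) DERIV_cong_ev[OF refl _ refl])
  then have "D * D = 1" using DERIV_unique DERIV_ident by blast
  moreover have "D \<le> 0"
  proof (rule tendsto_upperbound)
    show "((\<lambda>y. f y / y) \<longlongrightarrow> D) (at_right 0)"
      using f(2) f0 by (auto simp: has_field_derivative_iff intro: filterlim_mono at_le)
    have "\<forall>\<^sub>F y in at_right 0. (r (ereal y) = ereal (f y) \<and> a < ereal y \<and> ereal y < b) \<and> 0 < y"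
      using eventually_conj[OF f(1) in_ab] by (auto simp: eventually_at_filter elim: eventually_mono)
    then show "\<forall>\<^sub>F y in at_right 0. f y / y \<le> 0"
    proof eventually_elim
      case (elim y)
      then have "r (ereal y) < r 0" using ab by (intro monotone_onD[OF mono]) auto
      then show ?case using elim r0 by (simp add: divide_le_0_iff)
    qed
  qed simp
  ultimately have "D = - 1" by (auto simp: square_eq_1_iff)
  with f show ?thesis by (auto simp: has_finite_derivative_at_def)
qed

lemma asymp_equiv_neg_of_derivative:
  assumes "has_finite_derivative_at r (- 1) 0" "r 0 = 0"
  shows "(\<lambda>x. real_of_ereal (r (ereal x))) \<sim>[at 0] (\<lambda>x. - x)"
proof -
  obtain f where f: "\<forall>\<^sub>F y in nhds 0. r (ereal y) = ereal (f y)" "(f has_real_derivative - 1) (at 0)"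
    using assms(1) by (auto simp: has_finite_derivative_at_def)
  have "f 0 = 0"
    using eventually_nhds_x_imp_x[OF f(1)] assms(2) by (simp flip: zero_ereal_def)
  with f(2) have "((\<lambda>y. f y / y) \<longlongrightarrow> - 1) (at 0)" by (simp add: has_field_derivative_iff)
  from tendsto_minus[OF this] have "((\<lambda>y. f y / - y) \<longlongrightarrow> 1) (at 0)" by simp
  then have "f \<sim>[at 0] (\<lambda>x. - x)" by (rule asymp_equivI')
  moreover have "\<forall>\<^sub>F y in at 0. f y = real_of_ereal (r (ereal y))"
    using f(1) by (auto simp: eventually_at_filter elim: eventually_mono)
  ultimately show ?thesis 
    by (subst (asm) asymp_equiv_cong) auto
qed

subsection \<open>Measures with a prescribed function \<open>G\<close>\<close>

text \<open>A continuous, strictly increasing and bounded coordinate on the extended line, so that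
  points can be subtracted even when they are infinite.\<close>

definition ereal_arctan :: "ereal \<Rightarrow> real" where
  "ereal_arctan x = (if x = \<infinity> then pi / 2 else if x = - \<infinity> then - (pi / 2) else arctan (real_of_ereal x))"

lemma ereal_arctan_ereal [simp]: "ereal_arctan (ereal x) = arctan x"
  by (simp add: ereal_arctan_def)

lemma strict_mono_ereal_arctan: "strict_mono ereal_arctan"
proof (rule strict_monoI)
  fix x y :: ereal assume "x < y"
  then show "ereal_arctan x < ereal_arctan y"
    using arctan_bounded pi_gt_zero
    by (cases x; cases y) (auto simp: ereal_arctan_def arctan_less_iff)
qed

lemma continuous_on_ereal_arctan: "continuous_on UNIV ereal_arctan"
proof (intro continuous_at_imp_continuous_on ballI)
  fix x :: ereal
  show "isCont ereal_arctan x"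
  proof (cases x)
    case (real r)
    have "(ereal_arctan \<longlongrightarrow> ereal_arctan (ereal r)) (at (ereal r))"
      unfolding at_ereal tendsto_compose_filtermap[symmetric]
      using isCont_arctan[of r] by (simp add: isCont_def comp_def)
    then show ?thesis by (simp add: real isCont_def)
  next
    case PInf
    \<comment> \<open>Nothing lies above \<open>\<infinity>\<close>, and its left neighbourhood
      filter is the image of \<open>at_top\<close>; continuity thus becomes the limit of
      \<open>arctan\<close> at infinity.\<close>
    have "at (\<infinity> :: ereal) = at_left \<infinity>"
      using trivial_limit_at_right_top[where 'a = ereal] by (simp add: at_eq_sup_left_right top_ereal_def)
    then show ?thesis
      unfolding PInf isCont_def using tendsto_arctan_at_top
      by (simp add: at_left_PInf tendsto_compose_filtermap[symmetric] comp_def ereal_arctan_def)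
  next
    case MInf
    have "at (- \<infinity> :: ereal) = at_right (- \<infinity>)"
      using trivial_limit_at_left_bot[where 'a = ereal] by (simp add: at_eq_sup_left_right bot_ereal_def)
    then show ?thesis
      unfolding MInf isCont_def using tendsto_arctan_at_bot
      by (simp add: at_right_MInf tendsto_compose_filtermap[symmetric] comp_def ereal_arctan_def)
  qed
qed

text \<open>The signed square makes an increasing function out of an increasing profile while having
  the square as its absolute value; the modulus does not spoil the derivative at
  \<open>0\<close>.\<close>

lemma has_real_derivative_mult_abs:
  "((\<lambda>t :: real. t * \<bar>t\<bar>) has_real_derivative 2 * \<bar>x\<bar>) (at x)"
proof (cases x "0 :: real" rule: linorder_cases)
  case less
  have "((\<lambda>t. - (t * t)) has_real_derivative 2 * \<bar>x\<bar>) (at x)"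
    using less by (auto intro!: derivative_eq_intros)
  moreover have "\<forall>\<^sub>F t in nhds x. t * \<bar>t\<bar> = - (t * t)"
    using eventually_nhds_in_open[of "{..<0}" x] less by (auto elim: eventually_mono)
  ultimately show ?thesis by (subst DERIV_cong_ev[OF refl _ refl])
next
  case equal
  have "((\<lambda>t :: real. \<bar>t\<bar>) \<longlongrightarrow> 0) (at 0)" by (auto intro!: tendsto_eq_intros)
  moreover have "\<forall>\<^sub>F t :: real in at 0. \<bar>t\<bar> = (t * \<bar>t\<bar> - 0 * \<bar>0\<bar>) / (t - 0)"
    by (simp add: eventually_at_filter)
  ultimately show ?thesis
    unfolding equal has_field_derivative_iff by (auto intro: Lim_transform_eventually)
next
  case greater
  have "((\<lambda>t. t * t) has_real_derivative 2 * \<bar>x\<bar>) (at x)"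
    using greater by (auto intro!: derivative_eq_intros)
  moreover have "\<forall>\<^sub>F t in nhds x. t * \<bar>t\<bar> = t * t"
    using eventually_nhds_in_open[of "{0<..}" x] greater by (auto elim: eventually_mono)
  ultimately show ?thesis by (subst DERIV_cong_ev[OF refl _ refl])
qed

lemma mult_abs_strict_mono:
  fixes x y :: real
  assumes "x < y"
  shows "x * \<bar>x\<bar> < y * \<bar>y\<bar>"
proof (cases "0 \<le> x")
  case True
  then show ?thesis using assms mult_strict_mono'[of x y x y] by simp
next
  case False
  show ?thesis
  proof (cases "y \<le> 0")
    case True
    then show ?thesis using assms mult_strict_mono'[of "- y" "- x" "- y" "- x"] by simp
  next
    case y: False
    have "x * \<bar>x\<bar> < 0" "0 < y * \<bar>y\<bar>" using y False by (auto simp: mult_less_0_iff zero_less_mult_iff)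
    then show ?thesis by simp
  qed
qed

lemma mult_abs_mono: "x \<le> y \<Longrightarrow> x * \<bar>x\<bar> \<le> y * \<bar>y :: real\<bar>"
  using mult_abs_strict_mono[of x y] by (cases "x = y") auto

text \<open>Both measures are finite and have the same distribution function: zero up to
  \<open>s\<close>, then \<open>F x - F s\<close> by the fundamental theorem of calculus, and
  constant from \<open>t\<close> on.\<close>

lemma interval_measure_local_density:
  fixes F f :: "real \<Rightarrow> real"
  assumes "s < t" and mono: "\<And>x y. x \<le> y \<Longrightarrow> F x \<le> F y" and cont: "\<And>x. isCont F x"
    and deriv: "\<And>x. x \<in> {s..t} \<Longrightarrow> (F has_real_derivative f x) (at x)"
    and f: "continuous_on {s..t} f" "\<And>x. x \<in> {s..t} \<Longrightarrow> 0 \<le> f x"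
  shows "density (interval_measure F) (indicator {s<..t})
    = density lborel (\<lambda>x. ennreal (indicator {s<..t} x * f x))"
    (is "?M1 = ?M2")
proof -
  have rc: "\<And>x. continuous (at_right x) F" using cont continuous_at_imp_continuous_at_within by blast
  have Ioc: "emeasure (interval_measure F) {u<..v} = ennreal (F v - F u)" if "u \<le> v" for u v
    using that mono rc by (intro emeasure_interval_measure_Ioc) auto
  have fm [measurable]: "(\<lambda>x. indicator {s..t} x * f x) \<in> borel_measurable borel"
    using borel_measurable_continuous_on_indicator[OF _ f(1)] by simp
  have "(\<lambda>x. indicator {s<..t} x * f x) = (\<lambda>x. indicator {s<..t} x * (indicator {s..t} x * f x))"
    by (auto simp: indicator_def)
  then have fm' [measurable]: "(\<lambda>x. indicator {s<..t} x * f x) \<in> borel_measurable borel" by simp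
  have M1: "emeasure ?M1 X = emeasure (interval_measure F) ({s<..t} \<inter> X)" if "X \<in> sets borel" for X
    using that by (intro emeasure_restricted) auto
  have M2_eq: "emeasure ?M2 X = (\<integral>\<^sup>+z. ennreal (indicator {s<..t} z * f z) * indicator X z \<partial>lborel)"
    if "X \<in> sets borel" for X
    using that by (intro emeasure_density) auto
  have M2: "emeasure ?M2 {..x} = ennreal (F x - F s)" if "s \<le> x" "x \<le> t" for x
  proof -
    have "emeasure ?M2 {..x} = (\<integral>\<^sup>+z. ennreal (indicator {s<..t} z * f z) * indicator {..x} z \<partial>lborel)"
      by (intro M2_eq) auto
    \<comment> \<open>Adding the Lebesgue-null point \<open>s\<close> produces the closed interval
      that the fundamental theorem is stated for.\<close>
    also have "\<dots> = (\<integral>\<^sup>+z. ennreal (indicator {s..t} z * f z) * indicator {s..x} z \<partial>lborel)"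
      by (intro nn_integral_cong_AE, use AE_lborel_singleton[of s] in eventually_elim)
        (use that in \<open>auto simp: indicator_def\<close>)
    also have "\<dots> = ennreal (F x - F s)"
      using that deriv f(2) by (intro nn_integral_FTC_Icc) auto
    finally show ?thesis .
  qed
  have eq: "emeasure ?M1 {..x} = emeasure ?M2 {..x}" for x
  proof -
    consider "x \<le> s" | "s \<le> x" "x \<le> t" | "t \<le> x" by linarith
    then show ?thesis
    proof cases
      case 1
      then have "{s<..t} \<inter> {..x} = {}" by auto
      moreover have "emeasure ?M2 {..x} = (\<integral>\<^sup>+z. 0 \<partial>(lborel :: real measure))"
        using 1 by (subst M2_eq) (auto intro!: nn_integral_cong simp del: nn_integral_const simp: indicator_def)
      ultimately show ?thesis by (simp add: M1)
    next
      case 2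
      then have "{s<..t} \<inter> {..x} = {s<..x}" by auto
      with 2 show ?thesis by (simp add: M1 M2 Ioc)
    next
      case 3
      then have "{s<..t} \<inter> {..x} = {s<..t}" by auto
      moreover have "emeasure ?M2 {..x} = emeasure ?M2 {..t}"
        using 3 by (simp add: M2_eq) (auto intro!: nn_integral_cong simp: indicator_def)
      ultimately show ?thesis using \<open>s < t\<close> by (simp add: M1 M2 Ioc)
    qed
  qed
  have fin1: "emeasure ?M1 UNIV < \<infinity>" using \<open>s < t\<close> by (simp add: M1 Ioc)
  have "emeasure ?M2 UNIV = emeasure ?M2 {..t}"
    by (simp add: M2_eq) (auto intro!: nn_integral_cong simp: indicator_def)
  then have fin2: "emeasure ?M2 UNIV < \<infinity>" using \<open>s < t\<close> by (simp add: M2)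
  show ?thesis
  proof (rule cdf_unique')
    show "finite_borel_measure ?M1" "finite_borel_measure ?M2"
      using fin1 fin2
      by (auto simp: finite_borel_measure_def finite_borel_measure_axioms_def intro!: finite_measureI)
    show "cdf ?M1 = cdf ?M2" by (simp add: fun_eq_iff cdf_def measure_def eq)
  qed
qed

text \<open>The restriction of \<open>M\<close> to a supposed atom \<open>A\<close> has a continuous
  distribution function rising from \<open>0\<close> to the mass of \<open>A\<close>. It takes half
  that mass as a value, which cuts \<open>A\<close> into two halves.\<close>

lemma non_atomic_real:
  fixes M :: "real measure"
  assumes "finite_borel_measure M" and null: "\<And>x. emeasure M {x} = 0"
  shows "non_atomic M"
  unfolding non_atomic_def
proof
  interpret finite_borel_measure M by fact
  assume "\<exists>A. atom_of M A"
  then obtain A where A: "A \<in> sets M" "0 < emeasure M A"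
    and atom: "\<And>B. B \<in> sets M \<Longrightarrow> B \<subseteq> A \<Longrightarrow> emeasure M B = 0 \<or> emeasure M B = emeasure M A"
    by (auto simp: atom_of_def)
  define N where "N = density M (indicator A)"
  have N: "emeasure N X = emeasure M (A \<inter> X)" if "X \<in> sets M" for X
    using that A unfolding N_def by (intro emeasure_restricted)
  have [simp]: "space M = UNIV" using M_is_borel sets_eq_imp_space_eq by fastforce
  have "emeasure N (space N) \<noteq> \<infinity>"
    using N[of UNIV] sets.top[of M] by (simp add: N_def)
  then interpret N: finite_borel_measure N
    by (intro finite_borel_measure.intro finite_measureI finite_borel_measure_axioms.intro)
      (simp_all add: N_def M_is_borel)
  have singleton: "measure N {x} = 0" for x
    using N[of "{x}"] emeasure_mono[of "A \<inter> {x}" "{x}" M] null[of x] M_is_borel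
    by (simp add: measure_def)
  have total: "measure N (space N) = measure M A"
    using N[of UNIV] sets.top[of M] by (simp add: measure_def N_def)
  have "0 < measure M A" using A by (simp add: emeasure_eq_measure)
  then have half: "0 < measure M A / 2" "measure M A / 2 < measure M A" by auto
  obtain u where u: "cdf N u < measure M A / 2"
    using order_tendstoD(2)[OF N.cdf_lim_at_bot half(1)] eventually_happens'[OF trivial_limit_at_bot_linorder] by blast
  obtain v where v: "measure M A / 2 < cdf N v" 
    using order_tendstoD(1)[OF N.cdf_lim_at_top half(2)[folded total]] eventually_happens'[OF trivial_limit_at_top_linorder]
    unfolding total by blast
  have "u \<le> v" using u v N.cdf_nondecreasing[of v u] by linarith
  have "\<exists>x\<ge>u. x \<le> v \<and> cdf N x = measure M A / 2"
    using \<open>u \<le> v\<close> u v by (intro IVT) (auto simp: N.isCont_cdf singleton)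
  then obtain x where "measure N {..x} = measure M A / 2" by (auto simp: cdf_def)
  moreover have "{..x} \<in> sets M" using M_is_borel by simp
  moreover have "measure N {..x} = measure M (A \<inter> {..x})" 
    using N[OF \<open>{..x} \<in> sets M\<close>] by (simp add: measure_def)
  ultimately have "measure M (A \<inter> {..x}) = measure M A / 2" "A \<inter> {..x} \<in> sets M" using A by auto
  then show False using atom[of "A \<inter> {..x}"] half by (simp add: emeasure_eq_measure)
qed

section \<open>The measure with \<open>G\<close> proportional to the square of an increasing profile
  \<open>K\<close>\<close>

locale reflected_profile =
  fixes a b :: ereal and K :: "ereal \<Rightarrow> real" and k' :: "real \<Rightarrow> real" and d :: real
  assumes ab: "a < 0" "0 < b"
    and cont: "continuous_on UNIV K" and mono: "mono K"
    and strict: "\<And>x y. a \<le> x \<Longrightarrow> x < y \<Longrightarrow> y \<le> b \<Longrightarrow> K x < K y"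
    and zero: "K 0 = 0" and const_right: "\<And>x. b \<le> x \<Longrightarrow> K x = K b"
    and const_left: "\<And>x. x \<le> a \<Longrightarrow> K x = - K b"
    and d: "0 < d"
    and deriv: "\<And>x. x \<in> {-d<..<d} \<Longrightarrow> ((\<lambda>x. K (ereal x)) has_real_derivative k' x) (at x)"
    and k': "continuous_on {-d<..<d} k'" "\<And>x. x \<in> {-d<..<d} \<Longrightarrow> 0 < k' x"
begin

text \<open>The signed square of \<open>K\<close> tends to \<open>- (K b)^2\<close> at minus
  infinity; the added constant makes \<open>F\<close> a distribution function starting from
  \<open>0\<close>.\<close>

definition F :: "real \<Rightarrow> real" where
  "F x = K (ereal x) * \<bar>K (ereal x)\<bar> + (K b)^2"

abbreviation \<nu> :: "real measure" where "\<nu> \<equiv> interval_measure F"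

lemma F_mono: "x \<le> y \<Longrightarrow> F x \<le> F y"
  unfolding F_def using mult_abs_mono monoD[OF mono] by simp

lemma isCont_K_ereal: "isCont (\<lambda>x. K (ereal x)) x"
proof -
  have "continuous_on UNIV (\<lambda>x. K (ereal x))"
    by (rule continuous_on_compose2[OF cont]) (auto intro: continuous_on_ereal continuous_on_id)
  then show ?thesis by (simp add: continuous_on_eq_continuous_at)
qed

lemma isCont_F: "isCont F x"
  unfolding F_def
  by (intro continuous_add continuous_mult continuous_rabs continuous_const isCont_K_ereal)

lemma F_right_cont: "continuous (at_right x) F"
  using isCont_F continuous_at_imp_continuous_at_within by blast

lemma K_at_top: "((\<lambda>x. K (ereal x)) \<longlongrightarrow> K b) at_top"
proof -
  have "(K \<longlongrightarrow> K \<infinity>) (at_left \<infinity>)"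
    using cont by (auto simp: continuous_on_eq_continuous_at isCont_def intro: filterlim_mono at_le)
  then show ?thesis
    using const_right[of \<infinity>] by (simp add: at_left_PInf tendsto_compose_filtermap[symmetric] comp_def)
qed

lemma K_at_bot: "((\<lambda>x. K (ereal x)) \<longlongrightarrow> - K b) at_bot"
proof -
  have "(K \<longlongrightarrow> K (- \<infinity>)) (at_right (- \<infinity>))"
    using cont by (auto simp: continuous_on_eq_continuous_at isCont_def intro: filterlim_mono at_le)
  then show ?thesis
    using const_left[of "- \<infinity>"] by (simp add: at_right_MInf tendsto_compose_filtermap[symmetric] comp_def)
qed

lemma K_b_pos: "0 < K b"
  using strict[of 0 b] zero ab by simp

lemma F_at_top: "(F \<longlongrightarrow> 2 * (K b)^2) at_top"
proof -
  have "(F \<longlongrightarrow> K b * \<bar>K b\<bar> + (K b)^2) at_top"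
    unfolding F_def by (intro tendsto_intros K_at_top)
  then show ?thesis using K_b_pos by (simp add: power2_eq_square)
qed

lemma F_at_bot: "(F \<longlongrightarrow> 0) at_bot"
proof -
  have "(F \<longlongrightarrow> - K b * \<bar>- K b\<bar> + (K b)^2) at_bot"
    unfolding F_def by (intro tendsto_intros K_at_bot)
  then show ?thesis using K_b_pos by (simp add: power2_eq_square)
qed

sublocale \<nu>: finite_borel_measure \<nu>
  by (rule finite_borel_measure_interval_measure[OF F_mono F_right_cont F_at_bot F_at_top]) auto

lemma emeasure_Ioc: "u \<le> v \<Longrightarrow> emeasure \<nu> {u<..v} = ennreal (F v - F u)"
  by (rule emeasure_interval_measure_Ioc[OF _ F_mono F_right_cont])

lemma emeasure_singleton: "emeasure \<nu> {x} = 0"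
  using emeasure_interval_measure_Icc[of x x F] F_mono isCont_F
  by (simp add: continuous_at_imp_continuous_on)

lemma AE_neq: "AE z in \<nu>. z \<noteq> c"
  by (rule AE_I[of _ _ "{c}"]) (auto simp: emeasure_singleton)

text \<open>The mass between \<open>0\<close> and \<open>x\<close> is the increment of the signed
  square of \<open>K\<close>, which vanishes at \<open>0\<close>. For negative \<open>x\<close> the
  half-open interval is turned around at the cost of two null points.\<close>

lemma measure_segment0: "measure \<nu> (segment0 (ereal x)) = (K (ereal x))^2"
proof (cases "0 \<le> x")
  case True
  have "segment0 (ereal x) = {0<..x}" using True by (auto simp: segment0_nonneg_iff)
  moreover have "0 \<le> K (ereal x)" using monoD[OF mono, of 0 "ereal x"] True zero by simp
  ultimately show ?thesis
    using True F_mono[of 0 x] zero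
    by (simp add: measure_def emeasure_Ioc F_def power2_eq_square flip: zero_ereal_def)
next
  case False
  have "emeasure \<nu> (segment0 (ereal x)) = emeasure \<nu> {x<..0}"
  proof (rule emeasure_eq_AE)
    show "AE z in \<nu>. z \<in> segment0 (ereal x) \<longleftrightarrow> z \<in> {x<..0}"
      using AE_neq[of 0] AE_neq[of x]
    proof eventually_elim
      case (elim z)
      then show ?case using False by (subst segment0_nonpos_iff) auto
    qed
  qed auto
  moreover have "K (ereal x) \<le> 0" using monoD[OF mono, of "ereal x" 0] False zero by simp
  ultimately show ?thesis
    using False F_mono[of x 0] zero
    by (simp add: measure_def emeasure_Ioc F_def power2_eq_square flip: zero_ereal_def)
qed

text \<open>The factor in \<open>F' x = \<bar>x\<bar> * p x\<close>, extended to \<open>0\<close> by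
  continuity because \<open>K x / x\<close> tends to \<open>k' 0\<close>.\<close>

definition p :: "real \<Rightarrow> real" where
  "p x = (if x = 0 then 2 * (k' 0)^2 else 2 * (K (ereal x) / x) * k' x)"

lemma K_quotient_pos: "x \<in> {-d<..<d} \<Longrightarrow> x \<noteq> 0 \<Longrightarrow> 0 < K (ereal x) / x"
proof -
  assume x: "x \<in> {-d<..<d}" "x \<noteq> 0"
  have *: "K (ereal u) < K (ereal v)" if "u < v" "u \<in> {-d<..<d}" "v \<in> {-d<..<d}" for u v
  proof (rule DERIV_pos_imp_increasing[OF that(1)])
    fix z assume "u \<le> z" "z \<le> v"
    then have "z \<in> {-d<..<d}" using that(2,3) by auto
    then show "\<exists>y. ((\<lambda>x. K (ereal x)) has_real_derivative y) (at z) \<and> 0 < y"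
      using deriv k'(2) by blast
  qed
  show ?thesis
    using *[of 0 x] *[of x 0] x d zero
    by (cases x "0 :: real" rule: linorder_cases) (auto simp: zero_less_divide_iff simp flip: zero_ereal_def)
qed

lemma p_pos: "x \<in> {-d<..<d} \<Longrightarrow> 0 < p x"
  using K_quotient_pos[of x] k'(2)[of x] mult_pos_pos[of "2 * (K (ereal x) / x)" "k' x"]
  by (cases "x = 0") (auto simp: p_def)

lemma continuous_on_p: "continuous_on {-d<..<d} p"
proof (intro continuous_at_imp_continuous_on ballI)
  fix x assume x: "x \<in> {-d<..<d}"
  have k'x: "isCont k' x" using k'(1) x by (simp add: continuous_on_eq_continuous_at)
  show "isCont p x"
  proof (cases "x = 0")
    case True
    have "((\<lambda>y. K (ereal y) / y) \<longlongrightarrow> k' 0) (at 0)"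
      using deriv[OF x] True zero by (simp add: has_field_derivative_iff flip: zero_ereal_def)
    then have "((\<lambda>y. 2 * (K (ereal y) / y) * k' y) \<longlongrightarrow> 2 * k' 0 * k' 0) (at 0)"
      using k'x True by (intro tendsto_intros) (auto simp: isCont_def)
    moreover have "\<forall>\<^sub>F y in at 0. 2 * (K (ereal y) / y) * k' y = p y"
      by (simp add: eventually_at_filter p_def)
    ultimately have "(p \<longlongrightarrow> 2 * k' 0 * k' 0) (at 0)" by (rule Lim_transform_eventually)
    then show ?thesis using True by (simp add: isCont_def p_def power2_eq_square mult.assoc)
  next
    case False
    have "isCont (\<lambda>y. 2 * (K (ereal y) / y) * k' y) x"
      using k'x isCont_K_ereal False by (intro continuous_intros)
    moreover have "\<forall>\<^sub>F y in nhds x. p y = 2 * (K (ereal y) / y) * k' y"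
      using t1_space_nhds[OF False] by eventually_elim (simp add: p_def)
    ultimately show ?thesis by (simp add: isCont_cong)
  qed
qed

text \<open>The chain rule gives \<open>2 * \<bar>K x\<bar> * k' x\<close>; since \<open>K x\<close>
  has the sign of \<open>x\<close>, a factor \<open>\<bar>x\<bar>\<close> splits off.\<close>

lemma F_derivative:
  assumes x: "x \<in> {-d<..<d}"
  shows "(F has_real_derivative \<bar>x\<bar> * p x) (at x)"
proof -
  have "(F has_real_derivative 2 * \<bar>K (ereal x)\<bar> * k' x) (at x)"
    unfolding F_def
    using DERIV_add[OF DERIV_chain2[OF has_real_derivative_mult_abs deriv[OF x]] DERIV_const]
    by simp
  moreover have "2 * \<bar>K (ereal x)\<bar> * k' x = \<bar>x\<bar> * p x"
    using K_quotient_pos[OF x] zero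
    by (cases x "0 :: real" rule: linorder_cases) (auto simp: p_def zero_less_divide_iff abs_if simp flip: zero_ereal_def)
  ultimately show ?thesis by simp
qed

text \<open>Halving \<open>d\<close> puts the closure inside the domain of \<open>p\<close>, so that
  \<open>p\<close> is bounded on \<open>S\<close>.\<close>

abbreviation S :: "real set" where "S \<equiv> {-(d/2)<..d/2}"

lemma S_subset: "{-(d/2)..d/2} \<subseteq> {-d<..<d}"
  using d by auto

lemma \<nu>_local: "density \<nu> (indicator S) = density lborel (\<lambda>x. ennreal (indicator S x * (\<bar>x\<bar> * p x)))"
proof (rule interval_measure_local_density)
  show "continuous_on {-(d/2)..d/2} (\<lambda>x. \<bar>x\<bar> * p x)"
    using continuous_on_subset[OF continuous_on_p S_subset] by (intro continuous_intros)
  show "(F has_real_derivative \<bar>x\<bar> * p x) (at x)" "0 \<le> \<bar>x\<bar> * p x" if "x \<in> {-(d/2)..d/2}" for x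
    using F_derivative[of x] p_pos[of x] S_subset that by (auto simp: less_imp_le)
qed (use d F_mono isCont_F in auto)

lemma p_measurable [measurable]: "(\<lambda>x. indicator S x * p x) \<in> borel_measurable borel"
proof -
  have "continuous_on S p"
    by (rule continuous_on_subset[OF continuous_on_p]) (use d in auto)
  from borel_measurable_continuous_on_indicator[OF _ this] show ?thesis by simp
qed

text \<open>The weight \<open>1 / \<bar>z\<bar>\<close> cancels the factor
  \<open>\<bar>z\<bar>\<close> in the local density of \<open>\<nu>\<close>.\<close>

lemma nn_integral_\<nu>_local:
  assumes [measurable]: "u \<in> borel_measurable borel"
  shows "(\<integral>\<^sup>+z. indicator S z * (ennreal (1 / \<bar>z\<bar>) * u z) \<partial>\<nu>)
    = (\<integral>\<^sup>+z. ennreal (indicator S z * p z) * u z \<partial>lborel)"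
proof -
  have "(\<lambda>z. indicator S z * (\<bar>z\<bar> * p z)) = (\<lambda>z. \<bar>z\<bar> * (indicator S z * p z))" by auto
  then have [measurable]: "(\<lambda>z. indicator S z * (\<bar>z\<bar> * p z)) \<in> borel_measurable borel" by simp
  have "(\<integral>\<^sup>+z. indicator S z * (ennreal (1 / \<bar>z\<bar>) * u z) \<partial>\<nu>)
      = (\<integral>\<^sup>+z. ennreal (1 / \<bar>z\<bar>) * u z \<partial>density \<nu> (indicator S))"
    by (subst nn_integral_density) auto
  also have "\<dots> = (\<integral>\<^sup>+z. ennreal (indicator S z * (\<bar>z\<bar> * p z)) * (ennreal (1 / \<bar>z\<bar>) * u z) \<partial>lborel)"
    unfolding \<nu>_local by (subst nn_integral_density) measurable
  also have "\<dots> = (\<integral>\<^sup>+z. ennreal (indicator S z * p z) * u z \<partial>lborel)"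
  proof (rule nn_integral_cong_AE)
    show "AE z in lborel. ennreal (indicator S z * (\<bar>z\<bar> * p z)) * (ennreal (1 / \<bar>z\<bar>) * u z)
        = ennreal (indicator S z * p z) * u z"
      \<comment> \<open>At \<open>z = 0\<close> the convention \<open>1 / 0 = 0\<close> breaks the
        cancellation, so this point is discarded.\<close>
      using AE_lborel_singleton[of "0 :: real"]
    proof eventually_elim
      case (elim z)
      have "ennreal (\<bar>z\<bar> * p z) * ennreal (1 / \<bar>z\<bar>) = ennreal (p z)" if "z \<in> S"
        using elim that p_pos[of z] S_subset by (subst ennreal_mult[symmetric]) (auto simp: less_imp_le)
      then show ?case by (cases "z \<in> S") (simp_all flip: mult.assoc)
    qed
  qed
  finally show ?thesis .
qed

section \<open>Normalization to a probability measure\<close>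

definition M :: ennreal where "M = (\<integral>\<^sup>+z. ennreal (1 / \<bar>z\<bar>) \<partial>\<nu>)"

text \<open>On \<open>S\<close> the integral reduces to that of the bounded function
  \<open>p\<close>; off \<open>S\<close> the weight is at most \<open>2 / d\<close>, and
  \<open>\<nu>\<close> is finite.\<close>

lemma M_finite: "M < \<infinity>"
proof -
  have "M \<le> (\<integral>\<^sup>+z. indicator S z * (ennreal (1 / \<bar>z\<bar>) * 1) + ennreal (2 / d) \<partial>\<nu>)"
    unfolding M_def
  proof (rule nn_integral_mono)
    fix z
    have "1 / \<bar>z\<bar> \<le> 2 / d" if "z \<notin> S"
    proof -
      have "d / 2 \<le> \<bar>z\<bar>" using that by auto
      then show ?thesis using d by (simp add: field_simps)
    qed
    then show "ennreal (1 / \<bar>z\<bar>) \<le> indicator S z * (ennreal (1 / \<bar>z\<bar>) * 1) + ennreal (2 / d)"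
      by (cases "z \<in> S") (auto intro: ennreal_leI)
  qed
  also have "\<dots> = (\<integral>\<^sup>+z. indicator S z * (ennreal (1 / \<bar>z\<bar>) * 1) \<partial>\<nu>) + (\<integral>\<^sup>+z. ennreal (2 / d) \<partial>\<nu>)"
    by (intro nn_integral_add) auto
  also have "\<dots> < \<infinity>"
  proof -
    have "bounded (p ` {-(d/2)..d/2})"
      by (intro compact_imp_bounded compact_continuous_image continuous_on_subset[OF continuous_on_p S_subset]) simp
    then obtain B where "\<forall>z\<in>{-(d/2)..d/2}. \<bar>p z\<bar> \<le> B"
      by (auto simp: bounded_iff)
    then have B: "\<And>z. z \<in> {-(d/2)..d/2} \<Longrightarrow> \<bar>p z\<bar> \<le> B" by blast
    have "(\<integral>\<^sup>+z. indicator S z * (ennreal (1 / \<bar>z\<bar>) * 1) \<partial>\<nu>)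
        = (\<integral>\<^sup>+z. ennreal (indicator S z * p z) * 1 \<partial>lborel)"
      by (rule nn_integral_\<nu>_local) simp
    also have "\<dots> \<le> (\<integral>\<^sup>+z. ennreal B * indicator S z \<partial>lborel)"
    proof (rule nn_integral_mono)
      fix z
      have "p z \<le> B" if "z \<in> S" using B[of z] that by auto
      then show "ennreal (indicator S z * p z) * 1 \<le> ennreal B * indicator S z"
        by (auto simp: indicator_def intro: ennreal_leI)
    qed
    also have "\<dots> < \<infinity>" using d by (simp add: nn_integral_cmult_indicator ennreal_mult_less_top)
    finally have "(\<integral>\<^sup>+z. indicator S z * (ennreal (1 / \<bar>z\<bar>) * 1) \<partial>\<nu>) < \<infinity>" .
    moreover have "(\<integral>\<^sup>+z. ennreal (2 / d) \<partial>\<nu>) < \<infinity>"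
      using \<nu>.emeasure_finite[of UNIV] by (simp add: ennreal_mult_eq_top_iff flip: less_top)
    ultimately show ?thesis by simp
  qed
  finally show ?thesis .
qed

lemma M_pos: "0 < M"
proof (rule ccontr)
  assume "\<not> 0 < M"
  then have "AE z in \<nu>. ennreal (1 / \<bar>z\<bar>) = 0"
    unfolding M_def by (subst (asm) zero_less_iff_neq_zero) (simp add: nn_integral_0_iff_AE)
  with AE_neq[of 0] have "AE z in \<nu>. False" by eventually_elim simp
  then have "emeasure \<nu> UNIV = 0" by (simp add: AE_iff_null null_sets_def)
  moreover have "emeasure \<nu> UNIV = 2 * (K b)^2"
    by (rule interval_measure_UNIV[OF F_mono F_right_cont F_at_bot F_at_top]) auto
  ultimately show False using K_b_pos by simp
qed

definition C :: real where "C = enn2real M"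

lemma C_pos: "0 < C" and ennreal_C: "ennreal C = M"
  using M_pos M_finite by (auto simp: C_def enn2real_positive_iff)

text \<open>Dividing by \<open>\<bar>z\<bar>\<close> anticipates the factor
  \<open>\<bar>z\<bar>\<close> in \<open>Gfun_eq\<close>; \<open>C\<close> normalizes the mass to
  one.\<close>

definition \<mu> :: "real measure" where "\<mu> = density \<nu> (\<lambda>z. ennreal (1 / (C * \<bar>z\<bar>)))"

lemma sets_\<mu> [simp, measurable_cong]: "sets \<mu> = sets borel"
  by (simp add: \<mu>_def)

lemma weight_split: "ennreal (1 / (C * \<bar>z\<bar>)) = ennreal (1 / \<bar>z\<bar>) * ennreal (1 / C)"
  using C_pos by (subst ennreal_mult[symmetric]) (auto simp: mult.commute)

sublocale \<mu>: prob_space \<mu>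
proof
  have "emeasure \<mu> (space \<mu>) = (\<integral>\<^sup>+z. ennreal (1 / \<bar>z\<bar>) * ennreal (1 / C) \<partial>\<nu>)"
    unfolding \<mu>_def by (subst emeasure_density) (auto simp: weight_split)
  also have "\<dots> = ennreal C * ennreal (1 / C)"
    by (subst nn_integral_multc) (auto simp: ennreal_C M_def)
  also have "\<dots> = 1" using C_pos by (subst ennreal_mult[symmetric]) auto
  finally show "emeasure \<mu> (space \<mu>) = 1" .
qed

text \<open>The weight is positive except at the null point \<open>0\<close>. Hence null points and
  the support of \<open>\<mu>\<close> can be read off from \<open>F\<close>.\<close>

lemma \<mu>_null_iff:
  assumes [measurable]: "A \<in> sets borel"
  shows "emeasure \<mu> A = 0 \<longleftrightarrow> emeasure \<nu> A = 0"
proof -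
  have "emeasure \<mu> A = 0 \<longleftrightarrow> (AE z in \<nu>. ennreal (1 / (C * \<bar>z\<bar>)) * indicator A z = 0)"
    unfolding \<mu>_def by (subst emeasure_density) (auto simp: nn_integral_0_iff_AE)
  also have "\<dots> \<longleftrightarrow> (AE z in \<nu>. z \<notin> A)"
  proof
    assume "AE z in \<nu>. ennreal (1 / (C * \<bar>z\<bar>)) * indicator A z = 0"
    with AE_neq[of 0] show "AE z in \<nu>. z \<notin> A"
    proof eventually_elim
      case (elim z)
      then have "0 < ennreal (1 / (C * \<bar>z\<bar>))" using C_pos by simp
      with elim(2) show ?case by (auto simp: indicator_def split: if_splits)
    qed
  next
    assume "AE z in \<nu>. z \<notin> A"
    then show "AE z in \<nu>. ennreal (1 / (C * \<bar>z\<bar>)) * indicator A z = 0"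
      by eventually_elim simp
  qed
  also have "\<dots> \<longleftrightarrow> emeasure \<nu> A = 0" by (simp add: AE_iff_null null_sets_def)
  finally show ?thesis .
qed

section \<open>Moments, support and density of the constructed measure\<close>

lemma \<mu>_singleton: "emeasure \<mu> {x} = 0"
  by (simp add: \<mu>_null_iff emeasure_singleton)

lemma non_atomic_\<mu>: "non_atomic \<mu>"
proof (rule non_atomic_real)
  show "finite_borel_measure \<mu>"
    by (intro finite_borel_measure.intro \<mu>.finite_measure_axioms finite_borel_measure_axioms.intro) simp
qed (rule \<mu>_singleton)

sublocale \<mu>: first_moment \<mu>
proof
  \<comment> \<open>Expressed through \<open>\<nu>\<close>, the integrand is bounded by
    \<open>1 / C\<close>, and \<open>\<nu>\<close> is finite.\<close>
  have "integrable \<nu> (\<lambda>z. 1 / (C * \<bar>z\<bar>) * z)"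
  proof (rule \<nu>.integrable_const_bound[where B = "1 / C"])
    show "AE z in \<nu>. norm (1 / (C * \<bar>z\<bar>) * z) \<le> 1 / C" using C_pos by (auto simp: abs_mult)
  qed auto
  then show "integrable \<mu> (\<lambda>z. z)"
    unfolding \<mu>_def using C_pos by (subst integrable_density) auto
qed simp

text \<open>The weight cancels \<open>\<bar>z\<bar>\<close>, leaving the \<open>\<nu>\<close>-mass
  of the segment divided by \<open>C\<close>.\<close>

lemma Gfun_\<mu>_ereal: "Gfun \<mu> (ereal x) = (K (ereal x))^2 / C"
proof -
  have "Gfun \<mu> (ereal x) = (LINT z|\<nu>. 1 / (C * \<bar>z\<bar>) * (indicator (segment0 (ereal x)) z * \<bar>z\<bar>))"
    unfolding Gfun_eq \<mu>_def using C_pos by (subst integral_density) auto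
  also have "\<dots> = (LINT z|\<nu>. indicator (segment0 (ereal x)) z / C)"
    by (intro Bochner_Integration.integral_cong) (auto simp: indicator_def segment0_def)
  also have "\<dots> = (K (ereal x))^2 / C" by (simp add: measure_segment0)
  finally show ?thesis .
qed

text \<open>The infinite points follow from the real ones by passing to the limit on both
  sides.\<close>

lemma Gfun_\<mu>: "Gfun \<mu> x = (K x)^2 / C"
proof -
  have lim: "(Gfun \<mu> \<longlongrightarrow> Gfun \<mu> x) (at x)" for x
    using \<mu>.continuous_on_Gfun[OF \<mu>_singleton] by (simp add: continuous_on_eq_continuous_at isCont_def)
  show ?thesis
  proof (cases x)
    case (real y)
    then show ?thesis by (simp add: Gfun_\<mu>_ereal)
  next
    case PInf
    have "(Gfun \<mu> \<longlongrightarrow> Gfun \<mu> \<infinity>) (at_left \<infinity>)" using lim by (auto intro: filterlim_mono at_le)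
    then have "((\<lambda>x. (K (ereal x))^2 / C) \<longlongrightarrow> Gfun \<mu> \<infinity>) at_top"
      by (simp add: at_left_PInf tendsto_compose_filtermap[symmetric] comp_def Gfun_\<mu>_ereal)
    moreover have "((\<lambda>x. (K (ereal x))^2 / C) \<longlongrightarrow> (K b)^2 / C) at_top"
      using C_pos by (intro tendsto_intros K_at_top) auto
    ultimately show ?thesis
      using tendsto_unique[OF trivial_limit_at_top_linorder] const_right[of \<infinity>] PInf by auto
  next
    case MInf
    have "(Gfun \<mu> \<longlongrightarrow> Gfun \<mu> (- \<infinity>)) (at_right (- \<infinity>))" using lim by (auto intro: filterlim_mono at_le)
    then have "((\<lambda>x. (K (ereal x))^2 / C) \<longlongrightarrow> Gfun \<mu> (- \<infinity>)) at_bot"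
      by (simp add: at_right_MInf tendsto_compose_filtermap[symmetric] comp_def Gfun_\<mu>_ereal)
    moreover have "((\<lambda>x. (K (ereal x))^2 / C) \<longlongrightarrow> (- K b)^2 / C) at_bot"
      using C_pos by (intro tendsto_intros K_at_bot) auto
    ultimately show ?thesis
      using tendsto_unique[OF trivial_limit_at_bot_linorder] const_left[of "- \<infinity>"] MInf by auto
  qed
qed

text \<open>The end values \<open>K b\<close> and \<open>- K b\<close> have the same square, so
  \<open>Gfun\<close> agrees at both infinite points.\<close>

lemma zero_mean_\<mu>: "zero_mean \<mu>"
  using \<mu>.Gfun_infinity_diff \<mu>.first_moment const_right[of \<infinity>] const_left[of "- \<infinity>"]
  by (simp add: zero_mean_def Gfun_\<mu>)

text \<open>\<open>F\<close> is constant beyond \<open>a\<close> and \<open>b\<close>, which are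
  finite when some real lies beyond them, and strictly increasing in between.\<close>

lemma supp_\<mu>: "supp \<mu> = {x. a \<le> ereal x \<and> ereal x \<le> b}"
proof (intro set_eqI iffI)
  fix x assume x: "x \<in> supp \<mu>"
  have "\<not> b < ereal x"
  proof
    assume "b < ereal x"
    then obtain c where c: "b = ereal c" "c < x" using ab by (cases b) auto
    have "emeasure \<mu> {c<..<x+1} \<noteq> 0"
      using x c by (auto simp: supp_def zero_less_iff_neq_zero)
    moreover have "emeasure \<nu> {c<..<x+1} \<le> emeasure \<nu> {c<..x+1}" by (rule emeasure_mono) auto
    moreover have "F (x+1) = F c" unfolding F_def using const_right[of "ereal (x+1)"] c by simp
    then have "emeasure \<nu> {c<..x+1} = 0" using emeasure_Ioc[of c "x+1"] c(2) by simp
    ultimately show False by (simp add: \<mu>_null_iff)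
  qed
  moreover have "\<not> ereal x < a"
  proof
    assume "ereal x < a"
    then obtain c where c: "a = ereal c" "x < c" using ab by (cases a) auto
    have "emeasure \<mu> {x-1<..<c} \<noteq> 0"
      using x c by (auto simp: supp_def zero_less_iff_neq_zero)
    moreover have "emeasure \<nu> {x-1<..<c} \<le> emeasure \<nu> {x-1<..c}" by (rule emeasure_mono) auto
    moreover have "F (x-1) = F c"
      unfolding F_def using const_left[of "ereal (x-1)"] const_left[of "ereal c"] c by simp
    then have "emeasure \<nu> {x-1<..c} = 0" using emeasure_Ioc[of "x-1" c] c(2) by simp
    ultimately show False by (simp add: \<mu>_null_iff)
  qed
  ultimately show "x \<in> {x. a \<le> ereal x \<and> ereal x \<le> b}" by (simp add: not_less)
next
  fix x assume "x \<in> {x. a \<le> ereal x \<and> ereal x \<le> b}"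
  then have x: "a \<le> ereal x" "ereal x \<le> b" by auto
  have "emeasure \<mu> U \<noteq> 0" if U: "open U" "x \<in> U" for U
  proof -
    obtain e where e: "0 < e" "ball x e \<subseteq> U" using U openE by blast
    have U_I: "y \<in> U" if "\<bar>y - x\<bar> < e" for y
      using that e(2) by (auto simp: dist_real_def)
    \<comment> \<open>The interval extends to the right of \<open>x\<close>, except at
      \<open>x = b\<close>, where it has to extend to the left.\<close>
    have "\<exists>s t. s < t \<and> a \<le> ereal s \<and> ereal t \<le> b \<and> {s<..t} \<subseteq> U"
    proof (cases "ereal x < b")
      case True
      obtain c where c: "ereal x < ereal c" "ereal c < b" using ereal_dense2[OF True] by blast
      let ?t = "min c (x + e / 2)"
      have "{x<..?t} \<subseteq> U" using e(1) by (auto intro!: U_I)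
      moreover have "x < ?t" using c e(1) by auto
      moreover have "ereal ?t \<le> b" using c(2) by (simp add: min_def order.trans[OF _ less_imp_le[OF c(2)]])
      ultimately show ?thesis using x by blast
    next
      case False
      then have "a < ereal x" using ab x by order
      then obtain c where c: "a < ereal c" "ereal c < ereal x" using ereal_dense2 by blast
      let ?s = "max c (x - e / 2)"
      have "{?s<..x} \<subseteq> U" using e(1) by (auto intro!: U_I)
      moreover have "?s < x" using c e(1) by auto
      moreover have "a \<le> ereal ?s" using c(1) by (simp add: max_def order.trans[OF less_imp_le[OF c(1)]])
      ultimately show ?thesis using x by blast
    qed
    then obtain s t where st: "s < t" "a \<le> ereal s" "ereal t \<le> b" "{s<..t} \<subseteq> U" by blast
    have "K (ereal s) < K (ereal t)" using strict st by simp
    then have "F s < F t"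
      using mult_abs_strict_mono by (simp add: F_def)
    then have "0 < emeasure \<nu> {s<..t}" using st by (simp add: emeasure_Ioc)
    also have "\<dots> \<le> emeasure \<nu> U" using st U by (intro emeasure_mono) auto
    finally show ?thesis using U by (simp add: \<mu>_null_iff)
  qed
  then show "x \<in> supp \<mu>" by (auto simp: supp_def zero_less_iff_neq_zero)
qed

lemma cont_pos_density_\<mu>: "cont_pos_density_near_0 \<mu>"
  unfolding cont_pos_density_near_0_def
proof (intro exI conjI ballI impI)
  let ?U = "{-(d/2)<..<d/2}"
  have "?U \<subseteq> {-d<..<d}" using d by auto
  then show "continuous_on ?U (\<lambda>z. p z / C)"
    using continuous_on_subset[OF continuous_on_p] C_pos by (auto intro!: continuous_intros)
  show "0 < p z / C" if "z \<in> ?U" for z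
    using p_pos[of z] C_pos that \<open>?U \<subseteq> {-d<..<d}\<close> by auto
  fix A :: "real set" assume A: "A \<in> sets borel" "A \<subseteq> ?U"
  then have [measurable]: "A \<in> sets borel" by simp
  have "emeasure \<mu> A = (\<integral>\<^sup>+z. ennreal (1 / (C * \<bar>z\<bar>)) * indicator A z \<partial>\<nu>)"
    unfolding \<mu>_def by (intro emeasure_density) auto
  also have "\<dots> = (\<integral>\<^sup>+z. indicator S z * (ennreal (1 / \<bar>z\<bar>) * (ennreal (1 / C) * indicator A z)) \<partial>\<nu>)"
    using A(2) by (intro nn_integral_cong) (auto simp: weight_split indicator_def)
  also have "\<dots> = (\<integral>\<^sup>+z. ennreal (indicator S z * p z) * (ennreal (1 / C) * indicator A z) \<partial>lborel)"
    by (rule nn_integral_\<nu>_local) measurable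
  also have "\<dots> = (\<integral>\<^sup>+z\<in>A. ennreal (p z / C) \<partial>lborel)"
  proof (rule nn_integral_cong)
    fix z
    have "ennreal (p z) * ennreal (1 / C) = ennreal (p z / C)" if "z \<in> A"
      using that A(2) p_pos[of z] \<open>?U \<subseteq> {-d<..<d}\<close> C_pos
      by (subst ennreal_mult[symmetric]) (auto simp: less_imp_le)
    then show "ennreal (indicator S z * p z) * (ennreal (1 / C) * indicator A z)
        = ennreal (p z / C) * indicator A z"
      using A(2) by (cases "z \<in> A") (auto simp: indicator_def)
  qed
  finally show "emeasure \<mu> A = (\<integral>\<^sup>+z\<in>A. ennreal (p z / C) \<partial>lborel)" .
qed (use d in auto)

end

subsection \<open>The equivalence\<close>

lemma condition_I_imp_II:
  assumes ab: "a < 0" "0 < b" and "condition_I a b r"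
  shows "condition_II a b r"
proof -
  obtain \<mu> :: "real measure" where \<mu>: "sets \<mu> = sets borel" "prob_space \<mu>" "non_atomic \<mu>"
    "zero_mean \<mu>" "reciprocating \<mu> = r" "supp \<mu> = {x. a \<le> ereal x \<and> ereal x \<le> b}"
    "cont_pos_density_near_0 \<mu>"
    using assms(3) unfolding condition_I_def by blast
  interpret prob_space \<mu> by fact
  interpret first_moment \<mu> by standard (use \<mu> in \<open>auto simp: zero_mean_def\<close>)
  have "potential_well a b (Gfun \<mu>)"
    by (rule potential_well_Gfun) (use ab \<mu> in \<open>auto intro: non_atomic_singleton_null\<close>)
  then interpret potential_well a b "Gfun \<mu>" .
  have r: "r = opp" using reciprocating_eq_opp[OF potential_well_axioms] \<mu>(5) by simp
  obtain U p where U: "open U" "0 \<in> U" "continuous_on U p" "\<And>x. x \<in> U \<Longrightarrow> p x > (0::real)"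
    and dens: "\<And>A. A \<in> sets borel \<Longrightarrow> A \<subseteq> U \<Longrightarrow> emeasure \<mu> A = (\<integral>\<^sup>+x\<in>A. ennreal (p x) \<partial>lborel)"
    using \<mu>(7) unfolding cont_pos_density_near_0_def by blast
  obtain d where d: "0 < d" "ball 0 d \<subseteq> U" using U(1,2) openE by blast
  moreover have "ball 0 d = {-d<..<d}" by (simp add: ball_eq_greaterThanLessThan)
  ultimately have sub: "{-d<..<d} \<subseteq> U" by simp
  have "cont_diff_near_0 opp"
  proof (rule cont_diff_opp[OF d(1)])
    show p: "continuous_on {-d<..<d} p" by (rule continuous_on_subset[OF U(3) sub])
    show pos: "0 < p x" if "x \<in> {-d<..<d}" for x using U(4) sub that by blast
    show "((\<lambda>x. Gfun \<mu> (ereal x)) has_real_derivative x * p x) (at x)" if "x \<in> {-d<..<d}" for x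
      by (rule Gfun_derivative[OF p pos _ that]) (use dens sub in auto)
  qed
  then show ?thesis
    unfolding condition_II_def r
    using opp_zero opp_strict_antimono opp_continuous opp_left opp_right opp_opp by auto
qed

lemma condition_II_imp_I:
  assumes ab: "a < 0" "0 < b" and "condition_II a b r"
  shows "condition_I a b r"
proof -
  have r0: "r 0 = 0" and anti: "strict_antimono_on {a..b} r" and cont: "continuous_on UNIV r"
    and left: "\<And>x. x \<le> a \<Longrightarrow> r x = b" and right: "\<And>x. b \<le> x \<Longrightarrow> r x = a"
    and inv: "\<And>x. a \<le> x \<Longrightarrow> x \<le> b \<Longrightarrow> r (r x) = x" and diff: "cont_diff_near_0 r"
    using assms(3) unfolding condition_II_def by auto
  have "a \<le> b" using ab by order
  define c where "c x = max a (min b x)" for x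
  define K where "K x = ereal_arctan (c x) - ereal_arctan (r x)" for x
  have c_bounds: "a \<le> c x" "c x \<le> b" for x using \<open>a \<le> b\<close> by (auto simp: c_def)
  have c_id: "c x = x" if "a \<le> x" "x \<le> b" for x using that by (simp add: c_def)
  have c_mono: "c x \<le> c y" if "x \<le> y" for x y
    unfolding c_def by (intro max.mono min.mono order.refl that)
  \<comment> \<open>Since \<open>r\<close> is constant beyond \<open>a\<close> and \<open>b\<close>,
    it factors through the clamping; facts about \<open>r\<close> on the interval thus extend to the
    whole line.\<close>
  have r_c: "r x = r (c x)" for x
  proof (cases "x \<le> a")
    case True
    then have "c x = a" by (simp add: c_def min.coboundedI2)
    then show ?thesis using left[OF True] left[of a] by simp
  next
    case False
    then show ?thesis using right[of x] right[of b] \<open>a \<le> b\<close> by (cases "b \<le> x") (simp_all add: c_def)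
  qed
  have r_antimono: "r y \<le> r x" if "x \<le> y" for x y
  proof (cases "c x = c y")
    case True
    then show ?thesis using r_c[of x] r_c[of y] by simp
  next
    case False
    then have "r (c y) < r (c x)"
      using c_mono[OF that] c_bounds by (intro monotone_onD[OF anti]) auto
    then show ?thesis using r_c[of x] r_c[of y] by simp
  qed
  have r_bounds: "a \<le> r x" "r x \<le> b" for x
    using r_antimono[of "c x" b] r_antimono[of a "c x"] c_bounds[of x] left[of a] right[of b] r_c[of x] by auto
  \<comment> \<open>In this form the involution holds everywhere; it makes \<open>K\<close> odd
    under \<open>r\<close> and is the reason for \<open>c\<close> in place of the identity in
    \<open>K\<close>.\<close>
  have rr: "r (r x) = c x" for x
    using inv[OF c_bounds, of x] r_c[of x] by simp
  have K_r: "K (r x) = - K x" for x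
    by (simp add: K_def rr c_id r_bounds)
  have K_strict: "K x < K y" if "a \<le> x" "x < y" "y \<le> b" for x y
  proof -
    have "r y < r x" using that by (intro monotone_onD[OF anti]) auto
    then show ?thesis
      using that strict_monoD[OF strict_mono_ereal_arctan, of x y]
        strict_monoD[OF strict_mono_ereal_arctan, of "r y" "r x"] by (simp add: K_def c_id)
  qed
  have cont_c: "continuous_on UNIV c"
    unfolding c_def by (intro continuous_intros)
  have der0: "has_finite_derivative_at r (- 1) 0"
    by (rule derivative_of_involution_at_fixed_point[OF ab r0 anti _ diff]) (use inv in auto)
  define g where "g x = real_of_ereal (r (ereal x))" for x
  \<comment> \<open>Replaces the local representatives hidden in
    \<open>has_finite_derivative_at\<close> by the single function \<open>g\<close>.\<close>
  have der_g: "(g has_real_derivative D) (at x) \<and> (\<forall>\<^sub>F y in nhds x. r (ereal y) = ereal (g y))"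
    if D: "has_finite_derivative_at r D x" for D x
  proof -
    obtain f where f: "\<forall>\<^sub>F y in nhds x. r (ereal y) = ereal (f y)" "(f has_real_derivative D) (at x)"
      using D by (auto simp: has_finite_derivative_at_def)
    have "\<forall>\<^sub>F y in nhds x. g y = f y" using f(1) by eventually_elim (simp add: g_def)
    then have "(g has_real_derivative D) (at x)"
      using f(2) by (subst DERIV_cong_ev[OF refl _ refl])
    moreover have "\<forall>\<^sub>F y in nhds x. r (ereal y) = ereal (g y)"
      using f(1) by eventually_elim (simp add: g_def)
    ultimately show ?thesis ..
  qed
  obtain U D where U: "open U" "0 \<in> U" "\<And>x. x \<in> U \<Longrightarrow> has_finite_derivative_at r (D x) x" "continuous_on U D"
    using diff unfolding cont_diff_near_0_def by blast
  \<comment> \<open>With continuity of \<open>D\<close> this makes \<open>r\<close> have negative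
    derivative near \<open>0\<close>, whence both terms of \<open>k'\<close> contribute
    positively.\<close>
  have "D 0 = - 1"
    using der_g[OF der0] der_g[OF U(3)[OF U(2)]] DERIV_unique by blast
  moreover have "isCont D 0" using U by (simp add: continuous_on_eq_continuous_at)
  ultimately have "\<forall>\<^sub>F x in nhds 0. D x < 0"
    using tendsto_at_iff_tendsto_nhds[of D 0] order_tendstoD(2)[of D "- 1" "nhds 0" 0]
    by (simp add: isCont_def)
  moreover have "\<forall>\<^sub>F x in nhds 0. x \<in> U" using U(1,2) by (rule eventually_nhds_in_open)
  moreover have "((\<lambda>y. ereal y) \<longlongrightarrow> 0) (nhds 0)"
    by (simp add: zero_ereal_def filterlim_ident)
  then have "\<forall>\<^sub>F x in nhds 0. a < ereal x" "\<forall>\<^sub>F x in nhds 0. ereal x < b"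
    using ab by (simp_all add: order_tendstoD)
  ultimately have "\<forall>\<^sub>F x in nhds 0. D x < 0 \<and> x \<in> U \<and> a < ereal x \<and> ereal x < b"
    by eventually_elim simp
  then obtain d where d: "0 < d"
    "\<And>x. dist x 0 < d \<Longrightarrow> D x < 0 \<and> x \<in> U \<and> a < ereal x \<and> ereal x < b"
    unfolding eventually_nhds_metric by blast
  have near: "D x < 0" "x \<in> U" "a < ereal x" "ereal x < b" if "x \<in> {-d<..<d}" for x
    using d(2)[of x] that by (auto simp: dist_real_def)
  \<comment> \<open>The derivative of \<open>arctan x - arctan (g x)\<close>, which is
    \<open>K\<close> near \<open>0\<close>, where \<open>c\<close> is the identity.\<close>
  define k' where "k' x = inverse (1 + x^2) - inverse (1 + (g x)^2) * D x" for x
  have g: "(g has_real_derivative D x) (at x)" "\<forall>\<^sub>F y in nhds x. r (ereal y) = ereal (g y)"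
    if "x \<in> {-d<..<d}" for x
    using der_g[OF U(3)[OF near(2)[OF that]]] by auto
  interpret P: reflected_profile a b K k' d
  proof
    show "continuous_on UNIV K"
      unfolding K_def
      by (intro continuous_on_diff continuous_on_compose2[OF continuous_on_ereal_arctan cont_c]
          continuous_on_compose2[OF continuous_on_ereal_arctan cont]) auto
    show "mono K"
    proof (rule monoI)
      fix x y :: ereal assume "x \<le> y"
      then show "K x \<le> K y"
        using strict_mono_less_eq[OF strict_mono_ereal_arctan] c_mono r_antimono
        by (simp add: K_def diff_mono)
    qed
    show "K 0 = 0" using ab by (simp add: K_def c_id r0)
    show "K x = K b" if "b \<le> x" for x
      using that right[of b] right[of x] \<open>a \<le> b\<close> by (simp add: K_def c_def)
    show "K x = - K b" if "x \<le> a" for x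
      using that right[of b] left[of x] \<open>a \<le> b\<close> by (simp add: K_def c_def min.coboundedI2)
    fix x assume x: "x \<in> {-d<..<d}"
    have "((\<lambda>x. arctan x - arctan (g x)) has_real_derivative k' x) (at x)"
      unfolding k'_def
      by (intro DERIV_diff DERIV_arctan DERIV_chain2[OF DERIV_arctan g(1)[OF x]])
    moreover have "\<forall>\<^sub>F y in nhds x. K (ereal y) = arctan y - arctan (g y)"
      using g(2)[OF x] eventually_nhds_in_open[OF open_greaterThanLessThan x]
      by eventually_elim (use near(3,4) in \<open>simp add: K_def c_id less_imp_le\<close>)
    ultimately show "((\<lambda>x. K (ereal x)) has_real_derivative k' x) (at x)"
      by (subst DERIV_cong_ev[OF refl _ refl])
    have "0 < inverse (1 + x^2)" "0 < inverse (1 + (g x)^2)"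
      by (simp_all add: add_pos_nonneg)
    moreover have "inverse (1 + (g x)^2) * D x < 0"
      using near(1)[OF x] by (intro mult_pos_neg calculation)
    ultimately show "0 < k' x" unfolding k'_def by linarith
  next
    have "continuous_on {-d<..<d} g"
      using DERIV_isCont[OF g(1)] by (intro continuous_at_imp_continuous_on ballI)
    moreover have "continuous_on {-d<..<d} D"
      by (rule continuous_on_subset[OF U(4)]) (use near(2) in auto)
    moreover have "1 + x^2 \<noteq> 0" for x :: real
      using zero_le_power2[of x] by linarith
    ultimately show "continuous_on {-d<..<d} k'"
      unfolding k'_def by (intro continuous_intros) auto
  qed (use ab d(1) K_strict in auto)
  have "potential_well a b (Gfun P.\<mu>)"
    by (rule potential_well_Gfun)
      (use ab P.\<mu>_singleton P.zero_mean_\<mu> P.supp_\<mu> P.\<mu>.prob_space_axioms in auto)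
  then interpret W: potential_well a b "Gfun P.\<mu>" .
  \<comment> \<open>Both values have the same level, as \<open>Gfun\<close> is a multiple of the
    square of \<open>K\<close> and \<open>K (r x) = - K x\<close>; sides and bounds also agree, so
    \<open>opp_eqI\<close> applies.\<close>
  have "W.opp x = r x" for x
  proof (rule W.opp_eqI)
    show "0 \<le> x \<and> r x \<le> 0 \<or> x \<le> 0 \<and> 0 \<le> r x"
      using r_antimono[of 0 x] r_antimono[of x 0] r0 by (cases "0 \<le> x") auto
    show "Gfun P.\<mu> (r x) = Gfun P.\<mu> x" by (simp add: P.Gfun_\<mu> K_r)
  qed (rule r_bounds)+
  then have "reciprocating P.\<mu> = r"
    using reciprocating_eq_opp[OF W.potential_well_axioms] by (simp add: fun_eq_iff)
  then show ?thesis
    unfolding condition_I_def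
    using P.sets_\<mu> P.\<mu>.prob_space_axioms P.non_atomic_\<mu> P.zero_mean_\<mu> P.supp_\<mu> P.cont_pos_density_\<mu>
    by blast
qed

theorem proposition3p36:
  fixes a_minus a_plus :: ereal and r :: "ereal \<Rightarrow> ereal"
  assumes "-\<infinity> \<le> a_minus" and "a_minus < 0" and "0 < a_plus" and "a_plus \<le> \<infinity>"
  shows "(condition_I a_minus a_plus r \<longleftrightarrow> condition_II a_minus a_plus r) \<and>
    (condition_I a_minus a_plus r \<or> condition_II a_minus a_plus r \<longrightarrow>
       has_finite_derivative_at r (- 1) 0 \<and>
       (\<lambda>x. real_of_ereal (r (ereal x))) \<sim>[at 0] (\<lambda>x. - x))"
proof -
  have iff: "condition_I a_minus a_plus r \<longleftrightarrow> condition_II a_minus a_plus r"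
    using condition_I_imp_II condition_II_imp_I assms(2,3) by blast
  have "has_finite_derivative_at r (- 1) 0 \<and>
      (\<lambda>x. real_of_ereal (r (ereal x))) \<sim>[at 0] (\<lambda>x. - x)" if "condition_II a_minus a_plus r"
  proof
    have r: "r 0 = 0" "strict_antimono_on {a_minus..a_plus} r"
      "\<forall>x\<in>{a_minus..a_plus}. r (r x) = x" "cont_diff_near_0 r"
      using that by (auto simp: condition_II_def)
    show deriv: "has_finite_derivative_at r (- 1) 0"
      by (rule derivative_of_involution_at_fixed_point[OF assms(2,3) r])
    show "(\<lambda>x. real_of_ereal (r (ereal x))) \<sim>[at 0] (\<lambda>x. - x)"
      by (rule asymp_equiv_neg_of_derivative[OF deriv r(1)])
  qed
  with iff show ?thesis by blast
qed

end
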